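(* Let $[H,G]$ be a Boolean group-complemented interval of finite groups of rank $n+1$. Then $\hat{C}(H,G)$ is Cohen-Macaulay and $\tilde{\beta}_n(\Delta(C(H,G))) = \varphi(H,G)$ is nonzero.
   Context: An interval of finite groups $[H,G]$ is the lattice of all subgroups $K$ with $H \subseteq K \subseteq G$, where $G$ is a finite group and $H$ a subgroup. It is Boolean of rank $m$ if it is isomorphic to the lattice $\mathcal{B}_m$ of subsets of an $m$-element set; then each $K \in [H,G]$ has a unique lattice-complement $K^{\complement}$ (so $K \vee K^{\complement} = G$, $K \cap K^{\complement} = H$). A Boolean interval is group-complemented if $KK^{\complement} = G$ (as a product set) for every $K \in [H,G]$. The coset poset $C(H,G)$ is the set of all right cosets $Kg$ with $g \in G$ and $K \in [H,G]$, $K \neq G$, ordered by inclusion, and $\hat{C}(H,G) := C(H,G) \sqcup \{\emptyset, G\}$, also ordered by inclusion. The order complex $\Delta(P)$ of a finite poset $P$ is the simplicial complex whose faces are the chains of $P$. $\tilde{\beta}_i(\Delta)$ denotes the $i$th reduced Betti number, i.e. the dimension of the $i$th reduced homology (over $\mathbb{C}$) of $\Delta$. A finite poset is graded if it has a minimum and a maximum and all its maximal chains have the same length. A graded poset $Q$ is Cohen-Macaulay (over $\mathbb{C}$) if for every open interval $(x,y)$ in $Q$, $\tilde{\beta}_i(\Delta((x,y))) = 0$ for all $i < \dim \Delta((x,y))$. The Euler totient $\varphi(H,G)$ is the number of cosets $Hg$ ($g\in G$) such that $\langle Hg \rangle = G$, where $\langle Hg\rangle = \langle H, g\rangle$ is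 the subgroup generated by the coset. *)

theory Defs
  imports Complex_Main "HOL-Algebra.Coset" "HOL-Algebra.Generated_Groups"
begin

section \<open>Reduced homology of order complexes\<close>

definition order_complex :: "'v::order set \<Rightarrow> 'v set set" where
  "order_complex P = {\<sigma>. finite \<sigma> \<and> \<sigma> \<subseteq> P \<and> Complete_Partial_Order.chain (\<le>) \<sigma>}"

text \<open>
  The empty set is a face (of dimension \<open>-1\<close>) of every order complex; it provides the
  augmentation that makes the homology below reduced. Dimensions are integers for this reason.
\<close>

definition complex_dim :: "'v set set \<Rightarrow> int" where
  "complex_dim \<Delta> = int (Max (card ` \<Delta>)) - 1"

definition chain_space :: "'v set set \<Rightarrow> int \<Rightarrow> ('v set \<Rightarrow> complex) set" where
  "chain_space \<Delta> i = {f. \<forall>\<sigma>. f \<sigma> \<noteq> 0 \<longrightarrow> \<sigma> \<in> \<Delta> \<and> int (card \<sigma>) = i + 1}"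

text \<open>
  Each face \<open>\<sigma>\<close> of an order complex is oriented by the order of its vertices
  \<open>v\<^sub>0 < \<dots> < v\<^sub>k\<close>, and the boundary of \<open>\<sigma>\<close> is the sum of the \<open>(-1)^j (\<sigma> - {v\<^sub>j})\<close>.
  The definition gives the coefficient of the boundary of \<open>f\<close> at the face \<open>\<tau>\<close>.
\<close>

definition boundary :: "'v::order set set \<Rightarrow> ('v set \<Rightarrow> complex) \<Rightarrow> 'v set \<Rightarrow> complex" where
  "boundary \<Delta> f \<tau> =
     (\<Sum>v \<in> {v. v \<notin> \<tau> \<and> insert v \<tau> \<in> \<Delta>}. (-1) ^ card {u \<in> \<tau>. u < v} * f (insert v \<tau>))"

definition cycle_space :: "'v::order set set \<Rightarrow> int \<Rightarrow> ('v set \<Rightarrow> complex) set" where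
  "cycle_space \<Delta> i = {f \<in> chain_space \<Delta> i. boundary \<Delta> f = (\<lambda>\<tau>. 0)}"

definition boundary_space :: "'v::order set set \<Rightarrow> int \<Rightarrow> ('v set \<Rightarrow> complex) set" where
  "boundary_space \<Delta> i = boundary \<Delta> ` chain_space \<Delta> (i + 1)"

text \<open>
  For subspaces \<open>B \<subseteq> Z\<close> of a space of functions: the classes of the elements of \<open>S\<close>
  modulo \<open>B\<close> are pairwise distinct and form a basis of \<open>Z / B\<close>.
\<close>

definition quotient_basis ::
  "('x \<Rightarrow> complex) set \<Rightarrow> ('x \<Rightarrow> complex) set \<Rightarrow> ('x \<Rightarrow> complex) set \<Rightarrow> bool" where
  "quotient_basis Z B S \<longleftrightarrow>
     finite S \<and> S \<subseteq> Z \<and>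
     (\<forall>z\<in>Z. \<exists>c. (\<lambda>x. z x - (\<Sum>s\<in>S. c s * s x)) \<in> B) \<and>
     (\<forall>c. (\<lambda>x. \<Sum>s\<in>S. c s * s x) \<in> B \<longrightarrow> (\<forall>s\<in>S. c s = 0))"

definition quotient_dim :: "('x \<Rightarrow> complex) set \<Rightarrow> ('x \<Rightarrow> complex) set \<Rightarrow> nat" where
  "quotient_dim Z B = card (SOME S. quotient_basis Z B S)"

definition reduced_betti :: "'v::order set set \<Rightarrow> int \<Rightarrow> nat" where
  "reduced_betti \<Delta> i = quotient_dim (cycle_space \<Delta> i) (boundary_space \<Delta> i)"


section \<open>Graded and Cohen-Macaulay posets\<close>

definition maximal_chain :: "'v::order set \<Rightarrow> 'v set \<Rightarrow> bool" where
  "maximal_chain Q c \<longleftrightarrow>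
     c \<subseteq> Q \<and> Complete_Partial_Order.chain (\<le>) c \<and>
     (\<forall>d. d \<subseteq> Q \<and> Complete_Partial_Order.chain (\<le>) d \<and> c \<subseteq> d \<longrightarrow> d = c)"

definition graded_poset :: "'v::order set \<Rightarrow> bool" where
  "graded_poset Q \<longleftrightarrow>
     finite Q \<and> (\<exists>b\<in>Q. \<forall>x\<in>Q. b \<le> x) \<and> (\<exists>t\<in>Q. \<forall>x\<in>Q. x \<le> t) \<and>
     (\<forall>c d. maximal_chain Q c \<and> maximal_chain Q d \<longrightarrow> card c = card d)"

definition cohen_macaulay :: "'v::order set \<Rightarrow> bool" where
  "cohen_macaulay Q \<longleftrightarrow>
     graded_poset Q \<and>
     (\<forall>x\<in>Q. \<forall>y\<in>Q. x < y \<longrightarrow>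
        (\<forall>i < complex_dim (order_complex (Q \<inter> {x<..<y})).
           reduced_betti (order_complex (Q \<inter> {x<..<y})) i = 0))"


section \<open>Intervals of finite groups\<close>

definition subgroup_interval :: "('a, 'b) monoid_scheme \<Rightarrow> 'a set \<Rightarrow> 'a set set" where
  "subgroup_interval G H = {K. subgroup K G \<and> H \<subseteq> K}"

definition boolean_interval :: "('a, 'b) monoid_scheme \<Rightarrow> 'a set \<Rightarrow> nat \<Rightarrow> bool" where
  "boolean_interval G H m \<longleftrightarrow>
     (\<exists>f. bij_betw f (subgroup_interval G H) (Pow {..<m}) \<and>
          (\<forall>K\<in>subgroup_interval G H. \<forall>L\<in>subgroup_interval G H. K \<subseteq> L \<longleftrightarrow> f K \<subseteq> f L))"

definition lattice_complement :: "('a, 'b) monoid_scheme \<Rightarrow> 'a set \<Rightarrow> 'a set \<Rightarrow> 'a set" where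
  "lattice_complement G H K =
     (THE L. L \<in> subgroup_interval G H \<and> generate G (K \<union> L) = carrier G \<and> K \<inter> L = H)"

text \<open>Only meaningful for Boolean intervals, where lattice complements exist and are unique.\<close>

definition group_complemented :: "('a, 'b) monoid_scheme \<Rightarrow> 'a set \<Rightarrow> bool" where
  "group_complemented G H \<longleftrightarrow>
     (\<forall>K\<in>subgroup_interval G H. K <#>\<^bsub>G\<^esub> lattice_complement G H K = carrier G)"

definition coset_poset :: "('a, 'b) monoid_scheme \<Rightarrow> 'a set \<Rightarrow> 'a set set" where
  "coset_poset G H =
     {K #>\<^bsub>G\<^esub> g | K g. K \<in> subgroup_interval G H \<and> K \<noteq> carrier G \<and> g \<in> carrier G}"

definition coset_poset_hat :: "('a, 'b) monoid_scheme \<Rightarrow> 'a set \<Rightarrow> 'a set set" where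
  "coset_poset_hat G H = coset_poset G H \<union> {{}, carrier G}"

definition euler_totient :: "('a, 'b) monoid_scheme \<Rightarrow> 'a set \<Rightarrow> nat" where
  "euler_totient G H = card {X \<in> rcosets\<^bsub>G\<^esub> H. generate G X = carrier G}"

end

(*
Let M_i (i < N) be the coatoms of [H,G]. Every K in the interval is an intersection of
coatoms, so a coset Kg is determined by the cosets M_i g with K contained in M_i. Since M_i is
group-complemented by the atom contained in all the other coatoms, every tuple of cosets of
the M_i has a common point. Reversing inclusion, the coset poset is therefore the face poset
of the join of the N discrete sets G/M_i. The reduced homology of the join of discrete sets of
sizes p_i is concentrated in the top degree, where it has dimension the product of the
p_i - 1; this product counts the tuples avoiding every M_i, that is, the generating cosets.

Concentration is proved by induction, adding maximal elements to an acyclic poset one at a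
time: if P - {x} has homology only in degree d and the part below x only in degree d - 1, then
P has homology only in degree d and the ranks add up. Acyclicity comes from retractions onto
cones. Open intervals away from the bottom are proper parts of Boolean lattices and are
treated in the same way.
*)
theory Submission
  imports Defs "HOL-Library.Function_Algebras"
begin

section \<open>Dimensions of spaces of functions\<close>

text \<open>The rank is recorded only in the top degree \<open>d\<close>. There are no faces of
  dimension \<open>d + 1\<close>, so the homology in degree \<open>d\<close> is the space of
  \<open>d\<close>-cycles itself, and ranks add by rank-nullity instead of a long exact sequence.
  The choice hidden in \<open>quotient_dim\<close> then has to be resolved in two cases only: for
  the zero subspace, by the exchange argument, and for vanishing quotients.

  A vertex of the join is a maximal box, and the boxes strictly below it form the face poset of its
  link. Fix a colour \<open>m\<close> and a base point \<open>g\<close>. Removing the vertices of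
  colour \<open>m\<close> other than that of \<open>g\<close> leaves an acyclic poset, and each
  removed vertex has as its link the same construction with one colour fewer; this is the origin of
  the factor p_m - 1. It is also the reason for working with the boxes below an arbitrary box. The
  same posets are the open intervals starting at the empty set in the Cohen-Macaulay
  condition.\<close>

interpretation complex_fun: vector_space "\<lambda>(a::complex) (f::'x \<Rightarrow> complex) x. a * f x"
  by unfold_locales (auto simp: fun_eq_iff algebra_simps)

lemma sum_fun_apply: "(\<Sum>s\<in>S. F s) x = (\<Sum>s\<in>S. F s x)"
  by (induction S rule: infinite_finite_induct) auto

lemma quotient_basis_indep:
  assumes "quotient_basis Z B S" "(\<lambda>x. \<Sum>s\<in>S. c s * s x) \<in> B" "s \<in> S"
  shows "c s = 0"
proof -
  have "\<forall>c. (\<lambda>x. \<Sum>s\<in>S. c s * s x) \<in> B \<longrightarrow> (\<forall>s\<in>S. c s = 0)"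
    using assms(1) unfolding quotient_basis_def by (elim conjE)
  with assms(2,3) show ?thesis by simp
qed

lemma quotient_basis_span:
  assumes "quotient_basis Z {\<lambda>x. 0} S" "z \<in> Z"
  obtains c where "\<And>x. z x = (\<Sum>s\<in>S. c s * s x)"
proof -
  have "\<forall>z\<in>Z. \<exists>c. (\<lambda>x. z x - (\<Sum>s\<in>S. c s * s x)) \<in> {\<lambda>x. 0}"
    using assms(1) unfolding quotient_basis_def by (elim conjE)
  then obtain c where "(\<lambda>x. z x - (\<Sum>s\<in>S. c s * s x)) = (\<lambda>x. 0)"
    using assms(2) by blast
  then show thesis by (intro that[of c]) (simp add: fun_eq_iff)
qed

text \<open>Over the zero subspace a quotient basis is an ordinary finite basis, so the exchange
  bound in the vector space of functions applies. By symmetry all such bases have the same size,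
  which makes the choice in \<open>quotient_dim\<close> harmless.\<close>

lemma quotient_basis_card_le:
  fixes S T :: "('x \<Rightarrow> complex) set"
  assumes S: "quotient_basis Z {\<lambda>x. 0} S" and T: "quotient_basis Z {\<lambda>x. 0} T"
  shows "card S \<le> card T"
proof -
  have fin: "finite S" "finite T" and "S \<subseteq> Z"
    using S T by (auto simp: quotient_basis_def)
  have "complex_fun.independent S"
  proof (rule complex_fun.independent_if_scalars_zero[OF fin(1)])
    fix c s assume "(\<Sum>s\<in>S. (\<lambda>x. c s * s x)) = 0" "s \<in> S"
    moreover from this have "(\<lambda>x. \<Sum>s\<in>S. c s * s x) \<in> {\<lambda>x. 0}"
      by (auto simp: fun_eq_iff sum_fun_apply)
    ultimately show "c s = 0" using quotient_basis_indep[OF S] by blast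
  qed
  moreover have "S \<subseteq> complex_fun.span T"
  proof
    fix s assume "s \<in> S"
    then obtain c where "\<And>x. s x = (\<Sum>t\<in>T. c t * t x)"
      using quotient_basis_span[OF T] \<open>S \<subseteq> Z\<close> by blast
    then have "s = (\<Sum>t\<in>T. (\<lambda>x. c t * t x))"
      by (auto simp: fun_eq_iff sum_fun_apply)
    then show "s \<in> complex_fun.span T"
      using complex_fun.span_finite[OF fin(2)] by auto
  qed
  ultimately show ?thesis
    using complex_fun.independent_span_bound[OF fin(2)] by blast
qed

text \<open>A relation rather than a value: it asserts that a finite basis exists, which the choice
  in \<open>quotient_dim\<close> alone does not.\<close>

definition has_dim :: "('x \<Rightarrow> complex) set \<Rightarrow> nat \<Rightarrow> bool" where
  "has_dim Z k \<longleftrightarrow> (\<exists>S. quotient_basis Z {\<lambda>x. 0} S \<and> card S = k)"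

lemma quotient_dim_eq:
  assumes "has_dim Z k"
  shows "quotient_dim Z {\<lambda>x. 0} = k"
proof -
  obtain S where S: "quotient_basis Z {\<lambda>x. 0} S" "card S = k"
    using assms by (auto simp: has_dim_def)
  have "quotient_basis Z {\<lambda>x. 0} (SOME S. quotient_basis Z {\<lambda>x. 0} S)"
    using S(1) by (rule someI)
  with S show ?thesis
    unfolding quotient_dim_def by (metis quotient_basis_card_le le_antisym)
qed

text \<open>Only the empty set can be a basis: an element of a basis would lie in \<open>B\<close>
  and so be a vanishing combination with coefficient 1.\<close>

lemma quotient_dim_eq_0:
  assumes "Z \<subseteq> B" "(\<lambda>x. 0) \<in> B"
  shows "quotient_dim Z B = 0"
proof -
  have "quotient_basis Z B {}"
    using assms by (auto simp: quotient_basis_def)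
  moreover have "S = {}" if "quotient_basis Z B S" for S
  proof (rule ccontr)
    assume "S \<noteq> {}"
    then obtain s where s: "s \<in> S" by blast
    have fin: "finite S" and "s \<in> B"
      using that s assms(1) by (auto simp: quotient_basis_def)
    have "(\<Sum>t\<in>S. (if t = s then 1 else 0) * t x) = s x" for x
      using s fin by (simp add: if_distrib[of "\<lambda>a. a * _"] cong: if_cong)
    then have "(\<lambda>x. \<Sum>t\<in>S. (if t = s then 1 else 0) * t x) \<in> B"
      using \<open>s \<in> B\<close> by simp
    then show False using quotient_basis_indep[OF that _ s] by fastforce
  qed
  ultimately show ?thesis
    unfolding quotient_dim_def by (metis card.empty someI)
qed

lemma has_dim_zero: "Z = {\<lambda>x. 0} \<Longrightarrow> has_dim Z 0"
  unfolding has_dim_def by (rule exI[of _ "{}"]) (auto simp: quotient_basis_def)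

text \<open>Rank-nullity: a basis of the kernel together with arbitrary preimages of a basis of
  \<open>W\<close> is a basis of \<open>Z\<close>. Closure of \<open>Z\<close> is asked in the form
  in which a linear combination of lifts is subtracted term by term.\<close>

lemma has_dim_add:
  assumes add: "\<And>f g. T (\<lambda>x. f x + g x) = (\<lambda>y. T f y + T g y)"
    and scale: "\<And>a f. T (\<lambda>x. a * f x) = (\<lambda>y. a * T f y)"
    and sub: "\<And>a f g. f \<in> Z \<Longrightarrow> g \<in> Z \<Longrightarrow> (\<lambda>x. f x - a * g x) \<in> Z"
    and img: "\<And>f. f \<in> Z \<Longrightarrow> T f \<in> W" "\<And>w. w \<in> W \<Longrightarrow> \<exists>f\<in>Z. T f = w"
    and ker: "has_dim {f \<in> Z. T f = (\<lambda>y. 0)} k" and W: "has_dim W l"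
  shows "has_dim Z (k + l)"
proof -
  obtain K where K: "quotient_basis {f \<in> Z. T f = (\<lambda>y. 0)} {\<lambda>x. 0} K" "card K = k"
    using ker by (auto simp: has_dim_def)
  obtain B where B: "quotient_basis W {\<lambda>x. 0} B" "card B = l"
    using W by (auto simp: has_dim_def)
  have fin: "finite K" "finite B" and KZ: "K \<subseteq> Z" and KT: "\<And>s. s \<in> K \<Longrightarrow> T s = (\<lambda>y. 0)"
    and BW: "B \<subseteq> W"
    using K B by (auto simp: quotient_basis_def)
  define lift where "lift w = (SOME f. f \<in> Z \<and> T f = w)" for w
  have lift: "lift w \<in> Z" "T (lift w) = w" if "w \<in> B" for w
    using someI_ex[of "\<lambda>f. f \<in> Z \<and> T f = w"] img(2)[of w] BW that by (auto simp: lift_def)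
  have T0: "T (\<lambda>x. 0) = (\<lambda>y. 0)" using scale[of 0 "\<lambda>x. 0"] by simp
  have T_sum: "T (\<lambda>x. \<Sum>i\<in>A. c i * F i x) = (\<lambda>y. \<Sum>i\<in>A. c i * T (F i) y)"
    if "finite A" for A :: "'c set" and c F
    using that by induction (simp_all add: T0 add scale)
  have inj: "inj_on lift B" by (metis inj_onI lift(2))
  have nz: "w \<noteq> (\<lambda>y. 0)" if "w \<in> B" for w
  proof
    assume w: "w = (\<lambda>y. 0)"
    have "(\<lambda>x. \<Sum>s\<in>B. (if s = w then 1 else 0) * s x) \<in> {\<lambda>x. 0}"
      using w by (simp add: fun_eq_iff sum.neutral)
    then show False using quotient_basis_indep[OF B(1) _ that] by fastforce
  qed
  \<comment> \<open>Elements of \<open>K\<close> are sent to zero, lifts to basis elements, which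
    are nonzero.\<close>
  have disj: "K \<inter> lift ` B = {}"
    using KT lift(2) nz by fastforce
  have split: "(\<Sum>s\<in>K \<union> lift ` B. c s * s x) =
      (\<Sum>s\<in>K. c s * s x) + (\<Sum>w\<in>B. c (lift w) * lift w x)" for c x
    using fin disj by (simp add: sum.union_disjoint sum.reindex[OF inj])
  have "quotient_basis Z {\<lambda>x. 0} (K \<union> lift ` B)"
    unfolding quotient_basis_def
  proof (intro conjI ballI allI impI)
    fix z assume z: "z \<in> Z"
    then obtain c where c: "\<And>y. T z y = (\<Sum>w\<in>B. c w * w y)"
      using quotient_basis_span[OF B(1)] img(1) by blast
    define z' where "z' x = z x - (\<Sum>w\<in>B. c w * lift w x)" for x
    have "(\<lambda>x. z x - (\<Sum>w\<in>A. c w * lift w x)) \<in> Z" if "A \<subseteq> B" for A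
      using finite_subset[OF that fin(2)] that
    proof (induction A)
      case (insert a A)
      then show ?case
        using sub[of "\<lambda>x. z x - (\<Sum>w\<in>A. c w * lift w x)" "lift a" "c a"] lift(1)[of a]
        by (simp add: algebra_simps)
    qed (use z in simp)
    then have "z' \<in> Z" by (simp add: z'_def[abs_def])
    moreover have "T z' = (\<lambda>y. 0)"
    proof -
      have "z = (\<lambda>x. z' x + (\<Sum>w\<in>B. c w * lift w x))" by (simp add: z'_def)
      then have "T z = (\<lambda>y. T z' y + (\<Sum>w\<in>B. c w * T (lift w) y))"
        by (metis add T_sum[OF fin(2)])
      then show ?thesis using c lift(2) by (auto simp: fun_eq_iff)
    qed
    ultimately have "z' \<in> {f \<in> Z. T f = (\<lambda>y. 0)}" by simp
    then obtain d where d: "\<And>x. z' x = (\<Sum>s\<in>K. d s * s x)"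
      using quotient_basis_span[OF K(1)] by blast
    \<comment> \<open>One coefficient function must serve both parts of the union; on a lift,
      \<open>T\<close> recovers the basis element it came from.\<close>
    define e where "e s = (if s \<in> K then d s else c (T s))" for s
    have "(\<Sum>s\<in>K. e s * s x) = z' x" for x
      by (simp add: d e_def)
    moreover have "(\<Sum>w\<in>B. e (lift w) * lift w x) = (\<Sum>w\<in>B. c w * lift w x)" for x
      using disj lift(2) by (intro sum.cong) (auto simp: e_def)
    ultimately have "(\<lambda>x. z x - (\<Sum>s\<in>K \<union> lift ` B. e s * s x)) \<in> {\<lambda>x. 0}"
      by (simp add: split z'_def fun_eq_iff)
    then show "\<exists>c. (\<lambda>x. z x - (\<Sum>s\<in>K \<union> lift ` B. c s * s x)) \<in> {\<lambda>x. 0}" by (intro exI[of _ e])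
  next
    fix c s assume "(\<lambda>x. \<Sum>s\<in>K \<union> lift ` B. c s * s x) \<in> {\<lambda>x. 0}" and s: "s \<in> K \<union> lift ` B"
    then have 0: "(\<lambda>x. (\<Sum>s\<in>K. c s * s x) + (\<Sum>w\<in>B. c (lift w) * lift w x)) = (\<lambda>x. 0)"
      by (simp add: split)
    \<comment> \<open>Applying \<open>T\<close> kills the kernel part and isolates the coefficients
      of the lifts.\<close>
    from arg_cong[OF 0, of T] have "(\<lambda>y. (\<Sum>w\<in>B. c (lift w) * w y)) = (\<lambda>y. 0)"
      using KT lift(2) by (simp add: add T_sum fin T0 cong: sum.cong)
    then have cB: "\<forall>w\<in>B. c (lift w) = 0"
      using quotient_basis_indep[OF B(1), of "\<lambda>w. c (lift w)"] by simp
    with 0 have "(\<lambda>x. \<Sum>s\<in>K. c s * s x) = (\<lambda>x. 0)"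
      by (simp add: fun_eq_iff)
    then have "\<forall>s\<in>K. c s = 0"
      using quotient_basis_indep[OF K(1), of c] by simp
    then show "c s = 0" using s cB by auto
  qed (use fin KZ lift in auto)
  moreover have "card (K \<union> lift ` B) = k + l"
    using K(2) B(2) fin disj by (simp add: card_Un_disjoint card_image[OF inj])
  ultimately show ?thesis by (auto simp: has_dim_def)
qed

section \<open>Homology of order complexes\<close>

lemma order_complex_iff:
  "\<sigma> \<in> order_complex P \<longleftrightarrow> finite \<sigma> \<and> \<sigma> \<subseteq> P \<and> (\<forall>x\<in>\<sigma>. \<forall>y\<in>\<sigma>. x \<le> y \<or> y \<le> x)"
  by (auto simp: order_complex_def Complete_Partial_Order.chain_def)

lemma chain_space_iff:
  "f \<in> chain_space \<Delta> i \<longleftrightarrow> (\<forall>\<sigma>. f \<sigma> \<noteq> 0 \<longrightarrow> \<sigma> \<in> \<Delta> \<and> int (card \<sigma>) = i + 1)"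
  by (simp add: chain_space_def)

lemma order_complex_mono: "P \<subseteq> Q \<Longrightarrow> \<sigma> \<in> order_complex P \<Longrightarrow> \<sigma> \<in> order_complex Q"
  by (auto simp: order_complex_iff)

lemma chain_space_mono:
  "P \<subseteq> Q \<Longrightarrow> f \<in> chain_space (order_complex P) i \<Longrightarrow> f \<in> chain_space (order_complex Q) i"
  by (auto simp: chain_space_iff intro: order_complex_mono)

lemma chain_space_0: "(\<lambda>\<sigma>. 0) \<in> chain_space \<Delta> i"
  by (simp add: chain_space_iff)

lemma chain_space_combine:
  assumes "f \<in> chain_space \<Delta> i" "g \<in> chain_space \<Delta> i"
  shows "(\<lambda>\<sigma>. f \<sigma> - a * g \<sigma>) \<in> chain_space \<Delta> i"
  unfolding chain_space_iff
proof (intro allI impI)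
  fix \<sigma> assume "f \<sigma> - a * g \<sigma> \<noteq> 0"
  then have "f \<sigma> \<noteq> 0 \<or> g \<sigma> \<noteq> 0" by auto
  then show "\<sigma> \<in> \<Delta> \<and> int (card \<sigma>) = i + 1" using assms by (auto simp: chain_space_iff)
qed

text \<open>
  On chains of a subposet of \<open>R\<close> the boundary does not depend on the subposet, so one
  sum over \<open>R\<close> serves all subposets at once.
\<close>

definition face_sign :: "'v::order set \<Rightarrow> 'v \<Rightarrow> complex" where
  "face_sign \<tau> v = (-1) ^ card {u \<in> \<tau>. u < v}"

definition bd :: "'v::order set \<Rightarrow> ('v set \<Rightarrow> complex) \<Rightarrow> 'v set \<Rightarrow> complex" where
  "bd R f \<tau> = (\<Sum>v\<in>R - \<tau>. face_sign \<tau> v * f (insert v \<tau>))"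

lemma face_sign_square: "face_sign \<tau> v * (face_sign \<tau> v * a) = a"
proof -
  have "face_sign \<tau> v * face_sign \<tau> v = 1"
    unfolding face_sign_def power_mult_distrib[symmetric] by simp
  then show ?thesis by (metis mult.assoc mult_1)
qed

lemma face_sign_nonzero: "face_sign \<tau> v \<noteq> 0"
  by (simp add: face_sign_def)

lemma bd_combine: "bd R (\<lambda>\<sigma>. f \<sigma> - a * g \<sigma>) \<tau> = bd R f \<tau> - a * bd R g \<tau>"
  by (simp add: bd_def algebra_simps sum_subtractf sum_distrib_left)

lemma bd_single:
  assumes "finite R" "c \<in> R" "c \<notin> \<tau>"
    and "\<And>v. v \<in> R - \<tau> \<Longrightarrow> v \<noteq> c \<Longrightarrow> f (insert v \<tau>) = 0"
  shows "bd R f \<tau> = face_sign \<tau> c * f (insert c \<tau>)"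
proof -
  have "bd R f \<tau> = (\<Sum>v\<in>{c}. face_sign \<tau> v * f (insert v \<tau>))"
    unfolding bd_def using assms by (intro sum.mono_neutral_right) auto
  then show ?thesis by simp
qed

lemma boundary_eq:
  assumes "finite R" "P \<subseteq> R" "f \<in> chain_space (order_complex P) i"
  shows "boundary (order_complex P) f = bd R f"
proof
  fix \<tau>
  show "boundary (order_complex P) f \<tau> = bd R f \<tau>"
    unfolding boundary_def bd_def face_sign_def
    using assms by (intro sum.mono_neutral_left) (auto simp: order_complex_iff chain_space_iff)
qed

lemma cycle_iff:
  assumes "finite R" "P \<subseteq> R"
  shows "f \<in> cycle_space (order_complex P) i \<longleftrightarrow>
    f \<in> chain_space (order_complex P) i \<and> bd R f = (\<lambda>\<tau>. 0)"
  using boundary_eq[OF assms] by (auto simp: cycle_space_def)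

lemma boundary_iff:
  assumes "finite R" "P \<subseteq> R"
  shows "f \<in> boundary_space (order_complex P) i \<longleftrightarrow>
    (\<exists>g\<in>chain_space (order_complex P) (i + 1). f = bd R g)"
  using boundary_eq[OF assms] by (auto simp: boundary_space_def)

lemma bd_chain:
  assumes "f \<in> chain_space (order_complex P) (i + 1)"
  shows "bd R f \<in> chain_space (order_complex P) i"
  unfolding chain_space_iff
proof (intro allI impI)
  fix \<tau> assume "bd R f \<tau> \<noteq> 0"
  then obtain v where v: "v \<in> R - \<tau>" "f (insert v \<tau>) \<noteq> 0"
    unfolding bd_def by (auto elim!: sum.not_neutral_contains_not_neutral)
  with assms have "insert v \<tau> \<in> order_complex P" "int (card (insert v \<tau>)) = i + 2"
    unfolding chain_space_iff by auto
  moreover from this have "finite \<tau>" by (simp add: order_complex_iff)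
  ultimately show "\<tau> \<in> order_complex P \<and> int (card \<tau>) = i + 1"
    using v(1) by (simp add: order_complex_iff)
qed

text \<open>Inserting the smaller vertex first moves the larger one up by one position; inserting
  the larger one first moves nothing.\<close>

lemma face_sign_swap:
  assumes "finite \<tau>" "v \<notin> \<tau>" "v < w"
  shows "face_sign \<tau> v * face_sign (insert v \<tau>) w = - (face_sign \<tau> w * face_sign (insert w \<tau>) v)"
proof -
  have "{u \<in> insert v \<tau>. u < w} = insert v {u \<in> \<tau>. u < w}"
    "{u \<in> insert w \<tau>. u < v} = {u \<in> \<tau>. u < v}"
    using assms(3) by auto
  then show ?thesis
    using assms by (simp add: face_sign_def)
qed

text \<open>The double boundary is a sum over ordered pairs of distinct inserted vertices.
  Exchanging the two entries changes the sign of each term, so the sum equals its own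
  negative.\<close>

lemma bd_bd:
  assumes "finite R" and f: "f \<in> chain_space (order_complex P) i"
  shows "bd R (bd R f) = (\<lambda>\<tau>. 0)"
proof
  fix \<tau>
  define A where "A = (SIGMA v:R - \<tau>. R - insert v \<tau>)"
  define F where "F p = (case p of (v, w) \<Rightarrow>
    face_sign \<tau> v * face_sign (insert v \<tau>) w * f (insert w (insert v \<tau>)))" for p
  have inner: "face_sign \<tau> v * bd R f (insert v \<tau>) = (\<Sum>w\<in>R - insert v \<tau>. F (v, w))" for v
    by (simp add: bd_def F_def sum_distrib_left mult.assoc)
  have sum_F: "bd R (bd R f) \<tau> = sum F A"
    unfolding bd_def[of R "bd R f"] inner A_def using assms(1) by (subst sum.Sigma) auto
  have swap: "sum F A = (\<Sum>p\<in>A. F (prod.swap p))"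
  proof (rule sum.reindex_bij_betw[symmetric])
    have "prod.swap ` A = A" by (force simp: A_def)
    then show "bij_betw prod.swap A A" by (simp add: bij_betw_def)
  qed
  have anti: "F (prod.swap p) = - F p" if "p \<in> A" for p
  proof -
    obtain v w where p: "p = (v, w)" by (cases p)
    with that have vw: "v \<notin> \<tau>" "w \<notin> \<tau>" "v \<noteq> w" by (auto simp: A_def)
    show ?thesis
    \<comment> \<open>A nonzero term comes from a chain containing both vertices, so they are
      comparable and the sign rule applies.\<close>
    proof (cases "f (insert w (insert v \<tau>)) = 0")
      case False
      with f have "insert w (insert v \<tau>) \<in> order_complex P" by (simp add: chain_space_iff)
      then have "finite \<tau>" "v \<le> w \<or> w \<le> v" by (auto simp: order_complex_iff)
      then have "finite \<tau>" "v < w \<or> w < v" using vw(3) by auto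
      then show ?thesis
        using face_sign_swap[of \<tau> v w] face_sign_swap[of \<tau> w v] vw
        by (elim disjE) (simp_all add: F_def p insert_commute[of v w])
    qed (simp add: F_def p insert_commute)
  qed
  have "(\<Sum>p\<in>A. F (prod.swap p)) = - sum F A"
    unfolding sum_negf[symmetric] by (rule sum.cong[OF refl anti])
  with swap have "sum F A = - sum F A" by (rule trans)
  then show "bd R (bd R f) \<tau> = 0" unfolding sum_F by simp
qed

text \<open>
  The faces containing \<open>X\<close> are paired by inserting and deleting \<open>c\<close>, so a cycle can be
  pushed off all of them.
\<close>

lemma cycle_eq_bd_on_paired_faces:
  assumes "finite P" "c \<in> P" "c \<notin> X"
    and paired: "\<And>\<sigma>. \<sigma> \<in> order_complex P \<Longrightarrow> X \<subseteq> \<sigma> \<Longrightarrow> insert c \<sigma> \<in> order_complex P"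
    and f: "f \<in> cycle_space (order_complex P) i"
  obtains g where "g \<in> chain_space (order_complex P) (i + 1)" "\<And>\<sigma>. X \<subseteq> \<sigma> \<Longrightarrow> f \<sigma> = bd P g \<sigma>"
proof
  \<comment> \<open>Contraction towards \<open>c\<close>. The sign is the one carried by inserting
    \<open>c\<close>, so that \<open>face_sign_square\<close> returns \<open>f\<close> on the faces
    without \<open>c\<close>.\<close>
  define g where "g \<sigma> = (if c \<in> \<sigma> \<and> X \<subseteq> \<sigma> then face_sign (\<sigma> - {c}) c * f (\<sigma> - {c}) else 0)" for \<sigma>
  have fC: "f \<in> chain_space (order_complex P) i" and f0: "bd P f = (\<lambda>\<tau>. 0)"
    using f cycle_iff[OF assms(1) order_refl] by auto
  show g: "g \<in> chain_space (order_complex P) (i + 1)"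
    unfolding chain_space_iff
  proof (intro allI impI)
    fix \<sigma> assume "g \<sigma> \<noteq> 0"
    then have \<sigma>: "c \<in> \<sigma>" "X \<subseteq> \<sigma>" "f (\<sigma> - {c}) \<noteq> 0"
      by (auto simp: g_def split: if_splits)
    then have *: "\<sigma> - {c} \<in> order_complex P" "int (card (\<sigma> - {c})) = i + 1"
      using fC by (auto simp: chain_space_iff)
    moreover have "X \<subseteq> \<sigma> - {c}" using \<sigma> assms(3) by blast
    ultimately have "insert c (\<sigma> - {c}) \<in> order_complex P" by (intro paired)
    moreover have "card \<sigma> = Suc (card (\<sigma> - {c}))"
      using * \<sigma>(1) by (intro card.remove) (auto simp: order_complex_iff)
    ultimately show "\<sigma> \<in> order_complex P \<and> int (card \<sigma>) = i + 1 + 1"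
      using * \<sigma>(1) by (simp add: insert_absorb)
  qed
  define h where "h \<sigma> = f \<sigma> - 1 * bd P g \<sigma>" for \<sigma>
  have h0: "h \<tau> = 0" if "X \<subseteq> \<tau>" "c \<notin> \<tau>" for \<tau>
  proof -
    have "bd P g \<tau> = face_sign \<tau> c * g (insert c \<tau>)"
      using assms that by (intro bd_single) (auto simp: g_def)
    also have "g (insert c \<tau>) = face_sign \<tau> c * f \<tau>"
      using that by (auto simp: g_def)
    finally show ?thesis by (simp add: h_def face_sign_square)
  qed
  have "bd P h \<tau> = 0" for \<tau>
    unfolding h_def bd_combine using f0 bd_bd[OF assms(1) g] by simp
  \<comment> \<open>As \<open>h\<close> vanishes on the faces containing \<open>X\<close> but not
    \<open>c\<close>, the boundary at such a face has the single term that inserts \<open>c\<close>.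
    Since \<open>h\<close> is a cycle, that term is zero too.\<close>
  moreover have "bd P h (\<tau> - {c}) = face_sign (\<tau> - {c}) c * h \<tau>" if "X \<subseteq> \<tau>" "c \<in> \<tau>" for \<tau>
    using bd_single[OF assms(1,2), of "\<tau> - {c}" h] that assms(3)
    by (auto simp: insert_absorb intro: h0)
  ultimately have "h \<tau> = 0" if "X \<subseteq> \<tau>" for \<tau>
    using h0[OF that] that face_sign_nonzero by (metis mult_eq_0_iff)
  then show "f \<sigma> = bd P g \<sigma>" if "X \<subseteq> \<sigma>" for \<sigma>
    using that by (simp add: h_def)
qed

section \<open>Acyclic posets: cones, dominated elements, closure maps\<close>

definition acyclic_poset :: "'v::order set \<Rightarrow> bool" where
  "acyclic_poset P \<longleftrightarrow> finite P \<and>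
     (\<forall>i. cycle_space (order_complex P) i \<subseteq> boundary_space (order_complex P) i)"

text \<open>With \<open>X\<close> empty, inserting and deleting the apex pairs all faces, so the
  whole cycle bounds.\<close>

lemma acyclic_cone:
  assumes "finite P" "c \<in> P" "\<And>x. x \<in> P \<Longrightarrow> x \<le> c \<or> c \<le> x"
  shows "acyclic_poset P"
  unfolding acyclic_poset_def
proof (intro conjI allI subsetI)
  fix i f assume f: "f \<in> cycle_space (order_complex P) i"
  obtain g where g: "g \<in> chain_space (order_complex P) (i + 1)" "\<And>\<sigma>. {} \<subseteq> \<sigma> \<Longrightarrow> f \<sigma> = bd P g \<sigma>"
    by (rule cycle_eq_bd_on_paired_faces[OF assms(1,2) _ _ f, of "{}"])
      (use assms(2,3) in \<open>simp_all add: order_complex_iff, blast\<close>)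
  then have "f = bd P g" by auto
  with g(1) show "f \<in> boundary_space (order_complex P) i"
    using boundary_iff[OF assms(1) order_refl] by blast
qed (rule assms)

text \<open>The elements comparable to \<open>x\<close> form a cone over \<open>c\<close>. Pairing
  the faces through \<open>x\<close> by \<open>c\<close> therefore moves a cycle into
  \<open>P - {x}\<close>, where it bounds.\<close>

lemma acyclic_dominated:
  assumes "finite P" "x \<in> P" "c \<in> P" "c \<noteq> x"
    and dom: "\<And>y. y \<in> P \<Longrightarrow> y \<le> x \<or> x \<le> y \<Longrightarrow> y \<le> c \<or> c \<le> y"
    and acyclic: "acyclic_poset (P - {x})"
  shows "acyclic_poset P"
  unfolding acyclic_poset_def
proof (intro conjI allI subsetI)
  fix i f assume f: "f \<in> cycle_space (order_complex P) i"
  then have fC: "f \<in> chain_space (order_complex P) i" "bd P f = (\<lambda>\<tau>. 0)"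
    using cycle_iff[OF assms(1) order_refl] by auto
  obtain g where g: "g \<in> chain_space (order_complex P) (i + 1)" "\<And>\<sigma>. {x} \<subseteq> \<sigma> \<Longrightarrow> f \<sigma> = bd P g \<sigma>"
    by (rule cycle_eq_bd_on_paired_faces[OF assms(1,3) _ _ f, of "{x}"])
      (use assms(3,4) dom in \<open>simp_all add: order_complex_iff, blast\<close>)
  \<comment> \<open>The factor 1 gives the expression the shape required by
    \<open>chain_space_combine\<close> and \<open>bd_combine\<close>.\<close>
  define h where "h \<sigma> = f \<sigma> - 1 * bd P g \<sigma>" for \<sigma>
  have "h \<in> chain_space (order_complex P) i"
    unfolding h_def by (rule chain_space_combine[OF fC(1) bd_chain[OF g(1)]])
  moreover have "h \<sigma> = 0" if "x \<in> \<sigma>" for \<sigma> using g(2)[of \<sigma>] that by (simp add: h_def)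
  ultimately have "h \<in> chain_space (order_complex (P - {x})) i"
    unfolding chain_space_iff order_complex_iff by blast
  moreover have "bd P h = (\<lambda>\<tau>. 0)"
    unfolding h_def bd_combine using fC(2) bd_bd[OF assms(1) g(1)] by simp
  ultimately have "h \<in> cycle_space (order_complex (P - {x})) i"
    using cycle_iff[OF assms(1), of "P - {x}"] by blast
  then have "h \<in> boundary_space (order_complex (P - {x})) i"
    using acyclic by (auto simp: acyclic_poset_def)
  then obtain k where k: "k \<in> chain_space (order_complex (P - {x})) (i + 1)" "h = bd P k"
    using boundary_iff[OF assms(1), of "P - {x}"] by blast
  have k': "k \<in> chain_space (order_complex P) (i + 1)"
    by (rule chain_space_mono[OF _ k(1)]) blast
  have "(\<lambda>\<sigma>. g \<sigma> - (- 1) * k \<sigma>) \<in> chain_space (order_complex P) (i + 1)"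
    by (rule chain_space_combine[OF g(1) k'])
  moreover have "f = bd P (\<lambda>\<sigma>. g \<sigma> - (- 1) * k \<sigma>)"
    unfolding bd_combine k(2)[symmetric] by (simp add: h_def fun_eq_iff)
  ultimately show "f \<in> boundary_space (order_complex P) i"
    using boundary_iff[OF assms(1) order_refl] by blast
qed (rule assms)

text \<open>
  The order \<open>r\<close> is the given order or its dual. An element that is maximal with respect to
  \<open>r\<close> among those moved by \<open>f\<close> is dominated by its image.
\<close>

lemma acyclic_closure:
  fixes P :: "'v::order set"
  assumes "class.order r s" and comp: "\<And>x y. r x y \<or> r y x \<longleftrightarrow> x \<le> y \<or> y \<le> x"
    and "finite P" "\<And>x. x \<in> P \<Longrightarrow> f x \<in> P" "\<And>x. x \<in> P \<Longrightarrow> r x (f x)"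
    and "\<And>x. x \<in> P \<Longrightarrow> f (f x) = f x"
    and "\<And>x y. x \<in> P \<Longrightarrow> y \<in> P \<Longrightarrow> r x y \<Longrightarrow> r (f x) (f y)"
    and "acyclic_poset (f ` P)"
  shows "acyclic_poset P"
  using assms(3-)
proof (induction "card {x \<in> P. f x \<noteq> x}" arbitrary: P rule: less_induct)
  case less
  interpret le: order r s by fact
  show ?case
  proof (cases "{x \<in> P. f x \<noteq> x} = {}")
    case True
    then have "f ` P = P" by force
    with less.prems show ?thesis by simp
  next
    case False
    then obtain x where x: "x \<in> P" "f x \<noteq> x"
      and max: "\<And>y. y \<in> P \<Longrightarrow> f y \<noteq> y \<Longrightarrow> r x y \<Longrightarrow> x = y"
      using le.finite_has_maximal[of "{x \<in> P. f x \<noteq> x}"] less.prems(1) by auto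
    have removed: "acyclic_poset (P - {x})"
    proof (rule less.hyps)
      show "card {y \<in> P - {x}. f y \<noteq> y} < card {y \<in> P. f y \<noteq> y}"
        using x less.prems(1) by (intro psubset_card_mono) auto
      \<comment> \<open>The image loses nothing: by idempotence, \<open>f x\<close> is itself a
        preimage of \<open>f x\<close>.\<close>
      have "f ` P \<subseteq> f ` (P - {x})"
      proof
        fix z assume "z \<in> f ` P"
        then obtain y where "y \<in> P" "z = f y" by blast
        then show "z \<in> f ` (P - {x})"
          using x less.prems(2,4) by (cases "y = x") (auto intro: rev_image_eqI[of "f x"])
      qed
      then have "f ` (P - {x}) = f ` P" by blast
      then show "acyclic_poset (f ` (P - {x}))" using less.prems(6) by simp
      show "f y \<in> P - {x}" if "y \<in> P - {x}" for y
        using that x less.prems(2)[of y] less.prems(4)[of y] by auto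
    qed (use less.prems(1,3-5) in blast)+
    show ?thesis
    proof (rule acyclic_dominated[OF less.prems(1) x(1) less.prems(2)[OF x(1)] x(2) _ removed])
      fix y assume y: "y \<in> P" "y \<le> x \<or> x \<le> y"
      then consider "r y x" | "r x y" "x \<noteq> y" using comp le.order_refl by blast
      then have "r y (f x) \<or> r (f x) y"
      proof cases
        case 1
        then show ?thesis using le.order_trans less.prems(3)[OF x(1)] by blast
      next
        case 2
        \<comment> \<open>Maximality of \<open>x\<close> makes \<open>y\<close> fixed, so
          monotonicity carries the relation to \<open>f x\<close> and \<open>y\<close>.\<close>
        then have "f y = y" using max y(1) by blast
        then show ?thesis using less.prems(5)[OF x(1) y(1) 2(1)] by simp
      qed
      then show "y \<le> f x \<or> f x \<le> y" using comp by blast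
    qed
  qed
qed

text \<open>The bound on the faces makes the boundaries in degree \<open>d\<close> vanish, so the
  rank there is read off from the cycles. It is only an upper bound, which lets acyclic posets enter
  with \<open>k = 0\<close>.\<close>

definition concentrated :: "'v::order set \<Rightarrow> int \<Rightarrow> nat \<Rightarrow> bool" where
  "concentrated P d k \<longleftrightarrow> finite P \<and> (\<forall>\<sigma>\<in>order_complex P. int (card \<sigma>) \<le> d + 1) \<and>
     (\<forall>i<d. cycle_space (order_complex P) i \<subseteq> boundary_space (order_complex P) i) \<and>
     has_dim (cycle_space (order_complex P) d) k"

lemma zero_in_boundary_space: "(\<lambda>\<tau>. 0) \<in> boundary_space \<Delta> i"
proof -
  have "boundary \<Delta> (\<lambda>\<sigma>. 0) = (\<lambda>\<tau>. 0)" by (simp add: boundary_def fun_eq_iff)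
  then show ?thesis
    unfolding boundary_space_def by (metis chain_space_0 image_eqI)
qed

lemma boundary_space_top:
  assumes "\<forall>\<sigma>\<in>order_complex P. int (card \<sigma>) \<le> d + 1"
  shows "boundary_space (order_complex P) d = {\<lambda>\<tau>. 0}"
proof -
  have "chain_space (order_complex P) (d + 1) = {\<lambda>\<tau>. 0}"
    using assms by (force simp: chain_space_iff fun_eq_iff)
  then show ?thesis
    by (simp add: boundary_space_def boundary_def fun_eq_iff)
qed

lemma concentrated_betti:
  assumes "concentrated P d k"
  shows "reduced_betti (order_complex P) d = k"
    and "i < complex_dim (order_complex P) \<Longrightarrow> reduced_betti (order_complex P) i = 0"
proof -
  have fin: "finite P" and bound: "\<forall>\<sigma>\<in>order_complex P. int (card \<sigma>) \<le> d + 1"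
    using assms by (auto simp: concentrated_def)
  show "reduced_betti (order_complex P) d = k"
    using assms boundary_space_top[OF bound]
    by (simp add: reduced_betti_def concentrated_def quotient_dim_eq)
  have "finite (order_complex P)"
    by (rule finite_subset[of _ "Pow P"]) (auto simp: order_complex_iff fin)
  moreover have "{} \<in> order_complex P" by (simp add: order_complex_iff)
  ultimately have "Max (card ` order_complex P) \<in> card ` order_complex P"
    by (intro Max_in) auto
  \<comment> \<open>The actual dimension may be smaller than \<open>d\<close>; the inequality is
    enough to turn \<open>i < complex_dim\<close> into \<open>i < d\<close>.\<close>
  with bound have "complex_dim (order_complex P) \<le> d"
    by (force simp: complex_dim_def)
  then show "reduced_betti (order_complex P) i = 0" if "i < complex_dim (order_complex P)"
    using assms that unfolding reduced_betti_def concentrated_def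
    by (intro quotient_dim_eq_0 zero_in_boundary_space) simp
qed

text \<open>The empty poset is the sphere of dimension -1: its single face, the empty one, spans
  degree -1. Both computations for boxes bottom out here.\<close>

lemma concentrated_empty: "concentrated {} (-1) 1"
proof -
  have oc: "order_complex {} = {{} :: 'a set}" by (auto simp: order_complex_iff)
  have cyc: "cycle_space (order_complex {}) i = chain_space {{} :: 'a set} i" for i
    by (auto simp: oc cycle_space_def boundary_def fun_eq_iff)
  define \<delta> :: "'a set \<Rightarrow> complex" where "\<delta> \<sigma> = (if \<sigma> = {} then 1 else 0)" for \<sigma>
  have "quotient_basis (chain_space {{} :: 'a set} (-1)) {\<lambda>x. 0} {\<delta>}"
    unfolding quotient_basis_def
  proof (intro conjI ballI allI impI)
    fix z assume "z \<in> chain_space {{} :: 'a set} (-1)"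
    then have "(\<lambda>x. z x - (\<Sum>s\<in>{\<delta>}. z {} * s x)) \<in> {\<lambda>x. 0}"
      by (auto simp: chain_space_iff \<delta>_def fun_eq_iff)
    then show "\<exists>c. (\<lambda>x. z x - (\<Sum>s\<in>{\<delta>}. c s * s x)) \<in> {\<lambda>x. 0}"
      by (intro exI[of _ "\<lambda>_. z {}"])
  next
    fix c s assume "(\<lambda>x. \<Sum>s\<in>{\<delta>}. c s * s x) \<in> {\<lambda>x. 0}" "s \<in> {\<delta>}"
    then have "(\<lambda>x. c s * \<delta> x) = (\<lambda>x. 0)" by simp
    from fun_cong[OF this, of "{}"] show "c s = 0" by (simp add: \<delta>_def)
  qed (auto simp: chain_space_iff \<delta>_def)
  then have "has_dim (chain_space {{} :: 'a set} (-1)) 1"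
    by (auto simp: has_dim_def intro!: exI[of _ "{\<delta>}"])
  moreover have "chain_space {{} :: 'a set} i \<subseteq> {\<lambda>\<sigma>. 0}" if "i < -1" for i
    using that by (force simp: chain_space_iff fun_eq_iff)
  then have "\<forall>i< -1. chain_space {{} :: 'a set} i \<subseteq> boundary_space {{} :: 'a set} i"
    using zero_in_boundary_space by blast
  ultimately show ?thesis by (simp add: concentrated_def cyc) (simp add: oc)
qed

text \<open>In the top degree only zero is a boundary, so acyclicity leaves no other cycles.\<close>

lemma acyclic_concentrated:
  assumes "acyclic_poset P" and bound: "\<And>\<sigma>. \<sigma> \<in> order_complex P \<Longrightarrow> int (card \<sigma>) \<le> d + 1"
  shows "concentrated P d 0"
proof -
  have "cycle_space (order_complex P) d \<subseteq> {\<lambda>\<tau>. 0}"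
    using assms(1) boundary_space_top[of P d] bound by (auto simp: acyclic_poset_def)
  moreover have "(\<lambda>\<tau>. 0) \<in> cycle_space (order_complex P) d"
    by (simp add: cycle_space_def chain_space_0 boundary_def fun_eq_iff)
  ultimately show ?thesis
    using assms by (auto simp: concentrated_def acyclic_poset_def intro!: has_dim_zero)
qed

section \<open>Adding a maximal element\<close>

lemma chain_space_remove:
  assumes "f \<in> chain_space (order_complex P) i" "\<And>\<sigma>. x \<in> \<sigma> \<Longrightarrow> f \<sigma> = 0"
  shows "f \<in> chain_space (order_complex (P - {x})) i"
  using assms unfolding chain_space_iff order_complex_iff by blast

text \<open>No signs appear here or in \<open>cone\<close>: \<open>x\<close> will be the last vertex
  of each face containing it, so the other vertices keep their positions. On chains that avoid
  \<open>x\<close>, \<open>cone x\<close> is a right inverse of \<open>link x\<close>.\<close>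

definition link :: "'v \<Rightarrow> ('v set \<Rightarrow> complex) \<Rightarrow> 'v set \<Rightarrow> complex" where
  "link x f \<tau> = (if x \<in> \<tau> then 0 else f (insert x \<tau>))"

definition cone :: "'v \<Rightarrow> ('v set \<Rightarrow> complex) \<Rightarrow> 'v set \<Rightarrow> complex" where
  "cone x g \<tau> = (if x \<in> \<tau> then g (\<tau> - {x}) else 0)"

lemma link_remove: "x \<in> \<sigma> \<Longrightarrow> link x f (\<sigma> - {x}) = f \<sigma>"
  by (simp add: link_def insert_absorb)

context
  fixes P :: "'v::order set" and x :: 'v
  assumes finP: "finite P" and x: "x \<in> P" and maximal: "\<And>y. y \<in> P \<Longrightarrow> \<not> x < y"
begin

lemma link_chain:
  assumes "f \<in> chain_space (order_complex P) i"
  shows "link x f \<in> chain_space (order_complex (P \<inter> {..<x})) (i - 1)"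
  unfolding chain_space_iff
proof (intro allI impI)
  fix \<tau> assume "link x f \<tau> \<noteq> 0"
  then have x\<tau>: "x \<notin> \<tau>" and "f (insert x \<tau>) \<noteq> 0" by (auto simp: link_def split: if_splits)
  then have *: "insert x \<tau> \<in> order_complex P" "int (card (insert x \<tau>)) = i + 1"
    using assms by (auto simp: chain_space_iff)
  then have fin: "finite \<tau>" and sub: "\<tau> \<subseteq> P"
    and cmp: "\<And>y z. y \<in> \<tau> \<Longrightarrow> z \<in> \<tau> \<Longrightarrow> y \<le> z \<or> z \<le> y" "\<And>y. y \<in> \<tau> \<Longrightarrow> y \<le> x \<or> x \<le> y"
    by (auto simp: order_complex_iff)
  have "y < x" if "y \<in> \<tau>" for y
    using cmp(2)[OF that] maximal[of y] sub x\<tau> that by (auto simp: order.strict_iff_order)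
  then show "\<tau> \<in> order_complex (P \<inter> {..<x}) \<and> int (card \<tau>) = i - 1 + 1"
    using fin sub cmp(1) * x\<tau> by (auto simp: order_complex_iff)
qed

lemma cone_chain:
  assumes "g \<in> chain_space (order_complex (P \<inter> {..<x})) i"
  shows "cone x g \<in> chain_space (order_complex P) (i + 1)"
  unfolding chain_space_iff
proof (intro allI impI)
  fix \<sigma> assume "cone x g \<sigma> \<noteq> 0"
  then have x\<sigma>: "x \<in> \<sigma>" and "g (\<sigma> - {x}) \<noteq> 0" by (auto simp: cone_def split: if_splits)
  then have *: "\<sigma> - {x} \<in> order_complex (P \<inter> {..<x})" "int (card (\<sigma> - {x})) = i + 1"
    using assms by (auto simp: chain_space_iff)
  then have "insert x (\<sigma> - {x}) \<in> order_complex P"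
    using x by (auto simp: order_complex_iff subset_iff order.strict_iff_order)
  moreover have "card \<sigma> = Suc (card (\<sigma> - {x}))"
    using * x\<sigma> by (intro card.remove) (auto simp: order_complex_iff)
  ultimately show "\<sigma> \<in> order_complex P \<and> int (card \<sigma>) = i + 1 + 1"
    using * x\<sigma> by (simp add: insert_absorb)
qed

lemma face_sign_insert_maximal:
  assumes "v \<in> P"
  shows "face_sign (insert x \<tau>) v = face_sign \<tau> v" "face_sign (\<tau> - {x}) v = face_sign \<tau> v"
proof -
  have "{u \<in> insert x \<tau>. u < v} = {u \<in> \<tau>. u < v}" "{u \<in> \<tau> - {x}. u < v} = {u \<in> \<tau>. u < v}"
    using maximal[OF assms] by auto
  then show "face_sign (insert x \<tau>) v = face_sign \<tau> v" "face_sign (\<tau> - {x}) v = face_sign \<tau> v"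
    by (simp_all add: face_sign_def)
qed

lemma bd_link: "bd P (link x f) = link x (bd P f)"
proof
  fix \<tau>
  show "bd P (link x f) \<tau> = link x (bd P f) \<tau>"
  proof (cases "x \<in> \<tau>")
    case True
    then show ?thesis by (simp add: bd_def link_def)
  next
    case False
    have "bd P (link x f) \<tau> = (\<Sum>v\<in>P - insert x \<tau>. face_sign \<tau> v * link x f (insert v \<tau>))"
      unfolding bd_def using finP by (intro sum.mono_neutral_right) (auto simp: link_def)
    also have "\<dots> = (\<Sum>v\<in>P - insert x \<tau>. face_sign (insert x \<tau>) v * f (insert v (insert x \<tau>)))"
      using False by (intro sum.cong refl)
        (auto simp: link_def face_sign_insert_maximal insert_commute[of x])
    finally show ?thesis using False by (simp add: link_def bd_def)
  qed
qed

text \<open>Together with \<open>bd_cone_notin\<close> this is the Leibniz rule for a cone: on faces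
  through \<open>x\<close> one sees the cone over the boundary of \<open>g\<close>, on the others
  \<open>g\<close> itself, with the sign of deleting the last vertex.\<close>

lemma bd_cone_in:
  assumes "\<And>\<sigma>. x \<in> \<sigma> \<Longrightarrow> g \<sigma> = 0" "x \<in> \<tau>"
  shows "bd P (cone x g) \<tau> = bd P g (\<tau> - {x})"
proof -
  have "bd P g (\<tau> - {x}) = (\<Sum>v\<in>P - \<tau>. face_sign (\<tau> - {x}) v * g (insert v (\<tau> - {x})))"
    unfolding bd_def using finP assms
    by (intro sum.mono_neutral_right) (auto simp: insert_absorb)
  also have "\<dots> = bd P (cone x g) \<tau>"
    unfolding bd_def using assms(2)
    by (intro sum.cong refl) (auto simp: cone_def face_sign_insert_maximal insert_Diff_if)
  finally show ?thesis by simp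
qed

lemma bd_cone_notin:
  assumes g: "g \<in> chain_space (order_complex (P \<inter> {..<x})) i" and "x \<notin> \<tau>"
  shows "bd P (cone x g) \<tau> = (-1) ^ nat (i + 1) * g \<tau>"
proof -
  have "bd P (cone x g) \<tau> = face_sign \<tau> x * cone x g (insert x \<tau>)"
    using finP x assms(2) by (intro bd_single) (auto simp: cone_def)
  also have "\<dots> = (-1) ^ nat (i + 1) * g \<tau>"
  proof (cases "g \<tau> = 0")
    case False
    then have "\<tau> \<in> order_complex (P \<inter> {..<x})" "int (card \<tau>) = i + 1"
      using g by (auto simp: chain_space_iff)
    then have "{u \<in> \<tau>. u < x} = \<tau>" "card \<tau> = nat (i + 1)"
      by (auto simp: order_complex_iff)
    then show ?thesis
      using assms(2) by (simp add: cone_def face_sign_def)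
  qed (use assms(2) in \<open>simp add: cone_def\<close>)
  finally show ?thesis .
qed

lemma chain_below_vanishes:
  "g \<in> chain_space (order_complex (P \<inter> {..<x})) i \<Longrightarrow> x \<in> \<sigma> \<Longrightarrow> g \<sigma> = 0"
  unfolding chain_space_iff order_complex_iff by blast

text \<open>In degree \<open>d\<close>, taking links maps the cycles of \<open>P\<close> to the
  cycles below \<open>x\<close> in degree \<open>d - 1\<close>. The kernel consists of the cycles of
  \<open>P - {x}\<close>, and the map is onto because \<open>P - {x}\<close> has no homology in
  degree \<open>d - 1\<close>.\<close>

lemma concentrated_add_maximal:
  assumes rest: "concentrated (P - {x}) d k" and below: "concentrated (P \<inter> {..<x}) (d - 1) l"
  shows "concentrated P d (k + l)"
proof -
  let ?C = "\<lambda>P. chain_space (order_complex P)" and ?L = "P \<inter> {..<x}"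
  note iffP = cycle_iff[OF finP order_refl] boundary_iff[OF finP order_refl]
  have subs: "P - {x} \<subseteq> P" "?L \<subseteq> P" "?L \<subseteq> P - {x}" by auto
  note iffR = cycle_iff[OF finP subs(1)] boundary_iff[OF finP subs(1)]
  note iffL = cycle_iff[OF finP subs(2)] boundary_iff[OF finP subs(2)]
  have "int (card \<sigma>) \<le> d + 1" if \<sigma>: "\<sigma> \<in> order_complex P" for \<sigma>
  proof (cases "x \<in> \<sigma>")
    case True
    have "y < x" if "y \<in> \<sigma> - {x}" for y
      using maximal[of y] \<sigma> that True unfolding order_complex_iff
      by (auto simp: order.strict_iff_order)
    then have "\<sigma> - {x} \<in> order_complex ?L"
      using \<sigma> by (auto simp: order_complex_iff)
    then have "int (card (\<sigma> - {x})) \<le> d"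
      using below by (auto simp: concentrated_def)
    moreover have "card \<sigma> = Suc (card (\<sigma> - {x}))"
      using \<sigma> True by (intro card.remove) (auto simp: order_complex_iff)
    ultimately show ?thesis by simp
  next
    case False
    then have "\<sigma> \<in> order_complex (P - {x})" using \<sigma> by (auto simp: order_complex_iff)
    then show ?thesis using rest by (auto simp: concentrated_def)
  qed
  moreover have "cycle_space (order_complex P) i \<subseteq> boundary_space (order_complex P) i" if "i < d" for i
  proof
    fix f assume "f \<in> cycle_space (order_complex P) i"
    then have f: "f \<in> ?C P i" "bd P f = (\<lambda>\<tau>. 0)" by (auto simp: iffP)
    have "bd P (link x f) = (\<lambda>\<tau>. 0)"
      using f(2) by (simp add: bd_link link_def fun_eq_iff)
    then have "link x f \<in> cycle_space (order_complex ?L) (i - 1)"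
      using link_chain[OF f(1)] by (simp add: iffL)
    moreover have "cycle_space (order_complex ?L) (i - 1) \<subseteq> boundary_space (order_complex ?L) (i - 1)"
      using below that by (simp add: concentrated_def)
    ultimately have "link x f \<in> boundary_space (order_complex ?L) (i - 1)" by blast
    then obtain g where g: "g \<in> ?C ?L i" "link x f = bd P g"
      unfolding iffL(2) by auto
    note cg = cone_chain[OF g(1)]
    \<comment> \<open>The link of \<open>f\<close> bounds \<open>g\<close> below \<open>x\<close>,
      so the boundary of the cone over \<open>g\<close> agrees with \<open>f\<close> on all faces
      through \<open>x\<close>. What remains is a cycle of \<open>P - {x}\<close>.\<close>
    define h where "h \<sigma> = f \<sigma> - 1 * bd P (cone x g) \<sigma>" for \<sigma>
    have "h \<in> ?C P i"
      unfolding h_def by (rule chain_space_combine[OF f(1) bd_chain[OF cg]])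
    moreover have "h \<sigma> = 0" if "x \<in> \<sigma>" for \<sigma>
      using bd_cone_in[OF chain_below_vanishes[OF g(1)] that] link_remove[OF that, of f] g(2)
      by (simp add: h_def)
    ultimately have "h \<in> ?C (P - {x}) i" by (rule chain_space_remove)
    moreover have "bd P h = (\<lambda>\<tau>. 0)"
      unfolding h_def bd_combine using f(2) bd_bd[OF finP cg] by simp
    ultimately have "h \<in> cycle_space (order_complex (P - {x})) i"
      by (simp add: iffR)
    moreover have "cycle_space (order_complex (P - {x})) i \<subseteq> boundary_space (order_complex (P - {x})) i"
      using rest that by (simp add: concentrated_def)
    ultimately have "h \<in> boundary_space (order_complex (P - {x})) i" by blast
    then obtain u where u: "u \<in> ?C (P - {x}) (i + 1)" "h = bd P u"
      unfolding iffR(2) by blast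
    have "(\<lambda>\<sigma>. cone x g \<sigma> - (- 1) * u \<sigma>) \<in> ?C P (i + 1)"
      by (rule chain_space_combine[OF cg chain_space_mono[OF subs(1) u(1)]])
    moreover have "f = bd P (\<lambda>\<sigma>. cone x g \<sigma> - (- 1) * u \<sigma>)"
      unfolding bd_combine u(2)[symmetric] by (simp add: h_def fun_eq_iff)
    ultimately show "f \<in> boundary_space (order_complex P) i"
      unfolding iffP by blast
  qed
  moreover have "has_dim (cycle_space (order_complex P) d) (k + l)"
  proof (rule has_dim_add[where T = "link x" and W = "cycle_space (order_complex ?L) (d - 1)"])
    fix a f g
    assume "f \<in> cycle_space (order_complex P) d" "g \<in> cycle_space (order_complex P) d"
    then show "(\<lambda>\<sigma>. f \<sigma> - a * g \<sigma>) \<in> cycle_space (order_complex P) d"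
      by (auto simp: iffP bd_combine fun_eq_iff intro: chain_space_combine)
  next
    fix f assume "f \<in> cycle_space (order_complex P) d"
    then show "link x f \<in> cycle_space (order_complex ?L) (d - 1)"
      using link_chain[of f d] by (simp add: iffP iffL bd_link) (simp add: link_def fun_eq_iff)
  next
    fix w assume "w \<in> cycle_space (order_complex ?L) (d - 1)"
    then have w: "w \<in> ?C ?L (d - 1)" "bd P w = (\<lambda>\<tau>. 0)" by (auto simp: iffL)
    note w0 = chain_below_vanishes[OF w(1)]
    have "w \<in> cycle_space (order_complex (P - {x})) (d - 1)"
      using w chain_space_mono[OF subs(3) w(1)] by (simp add: iffR)
    moreover have "cycle_space (order_complex (P - {x})) (d - 1) \<subseteq>
        boundary_space (order_complex (P - {x})) (d - 1)"
      using rest by (simp add: concentrated_def)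
    ultimately have "w \<in> boundary_space (order_complex (P - {x})) (d - 1)" by blast
    then obtain u where u: "u \<in> ?C (P - {x}) d" "w = bd P u"
      unfolding iffR(2) by auto
    have u0: "u \<sigma> = 0" if "x \<in> \<sigma>" for \<sigma>
      using u(1) that unfolding chain_space_iff order_complex_iff by blast
    \<comment> \<open>Off the faces through \<open>x\<close>, the cone over \<open>w\<close> has
      boundary \<open>w\<close> up to the sign \<open>(-1) ^ nat d\<close>. As \<open>w\<close> also
      bounds \<open>u\<close> in \<open>P - {x}\<close>, subtracting \<open>u\<close> with this sign
      closes the cone to a cycle with link \<open>w\<close>.\<close>
    define f where "f \<sigma> = cone x w \<sigma> - (-1) ^ nat d * u \<sigma>" for \<sigma>
    have "cone x w \<in> ?C P d" using cone_chain[OF w(1)] by simp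
    then have "f \<in> ?C P d"
      unfolding f_def by (rule chain_space_combine[OF _ chain_space_mono[OF subs(1) u(1)]])
    moreover have "bd P f \<tau> = 0" for \<tau>
      unfolding f_def bd_combine u(2)[symmetric]
      using bd_cone_in[of w \<tau>, OF w0] bd_cone_notin[OF w(1), of \<tau>] w(2) w0[of \<tau>]
      by (cases "x \<in> \<tau>") auto
    moreover have "link x f = w"
      using w0 u0 by (auto simp: link_def f_def cone_def fun_eq_iff)
    ultimately show "\<exists>f\<in>cycle_space (order_complex P) d. link x f = w"
      by (intro bexI[of _ f]) (auto simp: iffP)
  next
    have "{f \<in> cycle_space (order_complex P) d. link x f = (\<lambda>\<tau>. 0)} =
        cycle_space (order_complex (P - {x})) d" (is "?K = ?Z")
    proof (intro equalityI subsetI)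
      fix f assume f: "f \<in> ?K"
      then have "f \<sigma> = 0" if "x \<in> \<sigma>" for \<sigma> using link_remove[OF that, of f] by simp
      with f show "f \<in> ?Z" by (auto simp: iffP iffR intro: chain_space_remove)
    next
      fix f assume f: "f \<in> ?Z"
      then have "f \<sigma> = 0" if "x \<in> \<sigma>" for \<sigma>
        using that unfolding iffR chain_space_iff order_complex_iff by blast
      then have "link x f = (\<lambda>\<tau>. 0)" by (simp add: link_def fun_eq_iff)
      with f show "f \<in> ?K" by (auto simp: iffP iffR intro: chain_space_mono[OF subs(1)])
    qed
    then show "has_dim {f \<in> cycle_space (order_complex P) d. link x f = (\<lambda>\<tau>. 0)} k"
      using rest by (simp add: concentrated_def)
  next
    show "has_dim (cycle_space (order_complex ?L) (d - 1)) l"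
      using below by (simp add: concentrated_def)
  qed (auto simp: link_def fun_eq_iff)
  ultimately show ?thesis using finP by (auto simp: concentrated_def)
qed

end

lemma concentrated_add_maximals:
  assumes "finite A" "finite P" "A \<subseteq> P" "\<And>a y. a \<in> A \<Longrightarrow> y \<in> P \<Longrightarrow> \<not> a < y"
    and "concentrated (P - A) d k"
    and "\<And>a. a \<in> A \<Longrightarrow> concentrated (P \<inter> {..<a}) (d - 1) l"
  shows "concentrated P d (k + card A * l)"
  using assms
proof (induction A arbitrary: P)
  case (insert a A)
  \<comment> \<open>Maximal elements are not below one another, so removing \<open>a\<close> does
    not change what lies below \<open>b\<close>.\<close>
  have eq: "(P - {a}) \<inter> {..<b} = P \<inter> {..<b}" if "b \<in> A" for b
    using insert.prems(2) insert.prems(3)[of a b] that by auto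
  have "concentrated (P - {a}) d (k + card A * l)"
  proof (rule insert.IH)
    show "A \<subseteq> P - {a}" using insert.prems(2) insert.hyps(2) by auto
    have "P - {a} - A = P - insert a A" by auto
    then show "concentrated (P - {a} - A) d k" using insert.prems(4) by simp
    show "concentrated ((P - {a}) \<inter> {..<b}) (d - 1) l" if "b \<in> A" for b
      using insert.prems(5)[of b] that by (simp add: eq)
  qed (use insert.prems(1,3) in auto)
  then have "concentrated P d (k + card A * l + l)"
    using insert.prems by (intro concentrated_add_maximal[of P a]) auto
  then show ?case using insert.hyps by (simp add: algebra_simps)
qed simp

section \<open>Graded posets from rank functions\<close>

text \<open>A maximal chain takes each rank exactly once: a missed rank would leave a gap into which
  \<open>dense\<close> puts an element comparable to the whole chain. Ranks decrease upwards because
  they will count the coordinates that a box fixes.\<close>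

lemma graded_posetI:
  fixes \<rho> :: "'v::order \<Rightarrow> nat"
  assumes fin: "finite Q" and b: "b \<in> Q" "\<And>x. x \<in> Q \<Longrightarrow> b \<le> x" "\<rho> b = N"
    and t: "t \<in> Q" "\<And>x. x \<in> Q \<Longrightarrow> x \<le> t" "\<rho> t = 0"
    and anti: "\<And>x y. x \<in> Q \<Longrightarrow> y \<in> Q \<Longrightarrow> x < y \<Longrightarrow> \<rho> y < \<rho> x"
    and dense: "\<And>x y. x \<in> Q \<Longrightarrow> y \<in> Q \<Longrightarrow> x < y \<Longrightarrow> \<rho> y + 1 < \<rho> x \<Longrightarrow> \<exists>z\<in>Q. x < z \<and> z < y"
  shows "graded_poset Q"
proof -
  have "card c = N + 1" if c: "maximal_chain Q c" for c
  proof -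
    have cQ: "c \<subseteq> Q" and cmp: "\<And>x y. x \<in> c \<Longrightarrow> y \<in> c \<Longrightarrow> x \<le> y \<or> y \<le> x"
      using c by (auto simp: maximal_chain_def Complete_Partial_Order.chain_def)
    have mem: "z \<in> c" if "z \<in> Q" "\<And>x. x \<in> c \<Longrightarrow> x \<le> z \<or> z \<le> x" for z
    proof -
      have "insert z c \<subseteq> Q" "Complete_Partial_Order.chain (\<le>) (insert z c)"
        using that cQ cmp by (auto simp: Complete_Partial_Order.chain_def)
      then have "insert z c = c" using c unfolding maximal_chain_def by blast
      then show ?thesis by blast
    qed
    have bc: "b \<in> c" and tc: "t \<in> c"
      using mem b t cQ by blast+
    have finc: "finite c" using cQ fin by (rule finite_subset)
    have less: "x < y" if "x \<in> c" "y \<in> c" "\<rho> y < \<rho> x" for x y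
      using cmp[OF that(1,2)] anti[of y x] that cQ by (force simp: order.strict_iff_order)
    have "r \<in> \<rho> ` c" if r: "r \<le> N" for r
    proof (rule ccontr)
      assume rc: "r \<notin> \<rho> ` c"
      define U where "U = {x \<in> c. \<rho> x < r}"
      define L where "L = {x \<in> c. r < \<rho> x}"
      have "r \<noteq> 0" "r \<noteq> N" using rc bc tc b(3) t(3) by (force, force)
      then have "t \<in> U" "b \<in> L" using r bc tc b(3) t(3) by (auto simp: U_def L_def)
      then have "finite U" "U \<noteq> {}" "finite L" "L \<noteq> {}"
        using finc by (auto simp: U_def L_def)
      \<comment> \<open>The largest rank in \<open>U\<close> belongs to its least element, the
        smallest rank in \<open>L\<close> to its greatest: these are the two neighbours of the
        gap.\<close>
      then have "Max (\<rho> ` U) \<in> \<rho> ` U" "Min (\<rho> ` L) \<in> \<rho> ` L" by simp_all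
      then obtain y x where y: "y \<in> U" "\<rho> y = Max (\<rho> ` U)" and x: "x \<in> L" "\<rho> x = Min (\<rho> ` L)"
        by (metis imageE)
      have xy: "x < y" "\<rho> y + 1 < \<rho> x"
        using x(1) y(1) less[of x y] by (auto simp: U_def L_def)
      then obtain z where z: "z \<in> Q" "x < z" "z < y"
        using dense[of x y] x(1) y(1) cQ by (auto simp: U_def L_def)
      have up: "y \<le> u" if "u \<in> U" for u
      proof -
        have "\<rho> u \<le> \<rho> y" using that y(2) \<open>finite U\<close> by simp
        moreover have "u \<in> c" "y \<in> c" using that y(1) by (auto simp: U_def)
        ultimately show ?thesis
          using cmp[of u y] anti[of u y] cQ by (force simp: order.strict_iff_order)
      qed
      have down: "u \<le> x" if "u \<in> L" for u
      proof -
        have "\<rho> x \<le> \<rho> u" using that x(2) \<open>finite L\<close> by simp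
        moreover have "u \<in> c" "x \<in> c" using that x(1) by (auto simp: L_def)
        ultimately show ?thesis
          using cmp[of u x] anti[of x u] cQ by (force simp: order.strict_iff_order)
      qed
      have UL: "u \<in> U \<or> u \<in> L" if "u \<in> c" for u
        using that rc by (force simp: U_def L_def)
      have "z \<in> c"
      proof (rule mem[OF z(1)])
        fix u assume "u \<in> c"
        then show "u \<le> z \<or> z \<le> u"
          using UL[of u] up[of u] down[of u] z(2,3) by (auto dest: order.strict_trans1 order.strict_trans2)
      qed
      then show False
        using UL[of z] up[of z] down[of z] z(2,3) by auto
    qed
    moreover have "\<rho> x \<le> N" if "x \<in> c" for x
      using anti[of b x] b cQ that by (cases "x = b") (force simp: order.strict_iff_order)+
    ultimately have "\<rho> ` c = {..N}" by auto
    moreover have "inj_on \<rho> c"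
      using less anti cQ by (intro inj_onI) (metis cmp less_irrefl order.strict_iff_order subsetD)
    ultimately show ?thesis by (metis card_atMost card_image Suc_eq_plus1)
  qed
  then show ?thesis
    using fin b(1,2) t(1,2) unfolding graded_poset_def by metis
qed


section \<open>Posets of boxes\<close>

text \<open>
  A point of \<open>X\<close> is given up to irrelevant data by its tuple of labels \<open>c i\<close>, and every tuple
  occurs. Reversing inclusion, the boxes are the faces of the join of the discrete sets
  \<open>c i ` X\<close>: the face of \<open>box T g\<close> has the vertices \<open>c i g\<close> for \<open>i \<in> T\<close>.
\<close>

locale box_system =
  fixes X :: "'a set" and I :: "'i set" and c :: "'i \<Rightarrow> 'a \<Rightarrow> 'l"
  assumes finite_X: "finite X" and X_nonempty: "X \<noteq> {}" and finite_I: "finite I"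
    and realize: "\<And>\<phi>. (\<And>i. i \<in> I \<Longrightarrow> \<phi> i \<in> c i ` X) \<Longrightarrow> \<exists>h\<in>X. \<forall>i\<in>I. c i h = \<phi> i"
    and other_label: "\<And>i g. i \<in> I \<Longrightarrow> g \<in> X \<Longrightarrow> \<exists>h\<in>X. c i h \<noteq> c i g"
begin

definition box :: "'i set \<Rightarrow> 'a \<Rightarrow> 'a set" where
  "box T g = {h \<in> X. \<forall>i\<in>T. c i h = c i g}"

definition boxes :: "'a set set" where
  "boxes = {box T g | T g. T \<subseteq> I \<and> g \<in> X}"

definition below :: "'i set \<Rightarrow> 'a \<Rightarrow> 'a set set" where
  "below T g = {box S h | S h. T \<subset> S \<and> S \<subseteq> I \<and> h \<in> box T g}"

text \<open>A single base point suffices: a box containing \<open>box S g\<close> contains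
  \<open>g\<close>. For \<open>T\<close> inside \<open>S\<close> this is the proper part of the
  Boolean lattice of the sets from \<open>T\<close> to \<open>S\<close>.\<close>

definition between :: "'i set \<Rightarrow> 'i set \<Rightarrow> 'a \<Rightarrow> 'a set set" where
  "between T S g = {box U g | U. T \<subset> U \<and> U \<subset> S}"

text \<open>Like \<open>rank\<close>, this is computed from the set alone, since a box has many base
  points. On boxes it frees the coordinate \<open>m\<close>; see \<open>forget_box\<close>.\<close>

definition forget :: "'i \<Rightarrow> 'a set \<Rightarrow> 'a set" where
  "forget m Y = {k \<in> X. \<exists>y\<in>Y. \<forall>i\<in>I - {m}. c i k = c i y}"

definition rank :: "'a set \<Rightarrow> nat" where
  "rank Y = card {i \<in> I. \<forall>y\<in>Y. \<forall>z\<in>Y. c i y = c i z}"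

lemma boxesI: "T \<subseteq> I \<Longrightarrow> g \<in> X \<Longrightarrow> box T g \<in> boxes"
  unfolding boxes_def by blast

lemma belowI: "T \<subset> S \<Longrightarrow> S \<subseteq> I \<Longrightarrow> h \<in> box T g \<Longrightarrow> box S h \<in> below T g"
  unfolding below_def by blast

lemma betweenI: "T \<subset> U \<Longrightarrow> U \<subset> S \<Longrightarrow> box U g \<in> between T S g"
  unfolding between_def by blast

lemma mem_box: "h \<in> box T g \<longleftrightarrow> h \<in> X \<and> (\<forall>i\<in>T. c i h = c i g)"
  by (simp add: box_def)

lemma box_self: "g \<in> X \<Longrightarrow> g \<in> box T g"
  by (simp add: mem_box)

lemma box_cong: "h \<in> box T g \<Longrightarrow> box T h = box T g"
  by (auto simp: box_def)

lemma box_in_X: "h \<in> box T g \<Longrightarrow> h \<in> X"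
  by (simp add: mem_box)

lemma merge:
  assumes "g \<in> X" "h \<in> X"
  obtains k where "k \<in> X" "\<And>i. i \<in> I \<Longrightarrow> i \<in> T \<Longrightarrow> c i k = c i g"
    "\<And>i. i \<in> I \<Longrightarrow> i \<notin> T \<Longrightarrow> c i k = c i h"
proof -
  have "\<exists>k\<in>X. \<forall>i\<in>I. c i k = (if i \<in> T then c i g else c i h)"
    by (rule realize) (use assms in auto)
  then obtain k where "k \<in> X" "\<forall>i\<in>I. c i k = (if i \<in> T then c i g else c i h)" ..
  then show thesis by (intro that[of k]) auto
qed

text \<open>If a colour of \<open>T\<close> were missing from \<open>S\<close>, then by
  \<open>other_label\<close> it could be changed at \<open>h\<close> without leaving
  \<open>box S h\<close>, and the result would leave \<open>box T g\<close>. Hence a box determines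
  its set of fixed colours.\<close>

lemma box_subset_iff:
  assumes "S \<subseteq> I" "T \<subseteq> I" "h \<in> X"
  shows "box S h \<subseteq> box T g \<longleftrightarrow> T \<subseteq> S \<and> h \<in> box T g"
proof
  assume sub: "box S h \<subseteq> box T g"
  have "h \<in> box T g" using sub box_self[OF assms(3), of S] by blast
  moreover have "t \<in> S" if t: "t \<in> T" for t
  proof (rule ccontr)
    assume "t \<notin> S"
    obtain h' where h': "h' \<in> X" "c t h' \<noteq> c t h" using other_label[of t h] t assms by blast
    obtain k where k: "k \<in> X" "\<And>i. i \<in> I \<Longrightarrow> i \<in> {t} \<Longrightarrow> c i k = c i h'"
      "\<And>i. i \<in> I \<Longrightarrow> i \<notin> {t} \<Longrightarrow> c i k = c i h"
      using merge[OF h'(1) assms(3), of "{t}"] by blast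
    have "k \<in> box S h" using k \<open>t \<notin> S\<close> assms(1) unfolding mem_box by blast
    with sub have "k \<in> box T g" by blast
    then have "c t k = c t g" using t by (simp add: mem_box)
    then show False
      using k(2)[of t] h'(2) \<open>h \<in> box T g\<close> t assms(2) by (auto simp: mem_box)
  qed
  ultimately show "T \<subseteq> S \<and> h \<in> box T g" by blast
next
  assume *: "T \<subseteq> S \<and> h \<in> box T g"
  show "box S h \<subseteq> box T g"
  proof
    fix k assume k: "k \<in> box S h"
    have "c i k = c i g" if "i \<in> T" for i
      using k * that unfolding mem_box by (metis subsetD)
    then show "k \<in> box T g" using k by (simp add: mem_box)
  qed
qed

lemma box_less_iff:
  assumes "S \<subseteq> I" "T \<subseteq> I" "h \<in> X" "g \<in> X"
  shows "box S h < box T g \<longleftrightarrow> T \<subset> S \<and> h \<in> box T g"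
  using box_subset_iff[OF assms(1-3), of g] box_subset_iff[OF assms(2,1,4), of h]
  by (auto simp: less_le_not_le mem_box)

lemma box_eq_iff:
  assumes "S \<subseteq> I" "T \<subseteq> I" "h \<in> X" "g \<in> X"
  shows "box S h = box T g \<longleftrightarrow> S = T \<and> h \<in> box T g"
  using box_subset_iff[OF assms(1-3), of g] box_subset_iff[OF assms(2,1,4), of h]
  by (auto simp: mem_box)

lemma box_Int: "p \<in> box S h \<Longrightarrow> p \<in> box T g \<Longrightarrow> box S h \<inter> box T g = box (S \<union> T) p"
  by (auto simp: mem_box)

lemma forget_box:
  assumes "S \<subseteq> I" "h \<in> X"
  shows "forget m (box S h) = box (S - {m}) h"
proof (intro equalityI subsetI)
  fix k assume "k \<in> forget m (box S h)"
  then obtain y where "k \<in> X" "y \<in> box S h" "\<forall>i\<in>I - {m}. c i k = c i y"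
    by (auto simp: forget_def)
  moreover from this have "c i k = c i h" if "i \<in> S - {m}" for i
    using that assms(1) unfolding mem_box by (metis DiffD1 DiffD2 DiffI subsetD)
  ultimately show "k \<in> box (S - {m}) h" unfolding mem_box by blast
next
  fix k assume k: "k \<in> box (S - {m}) h"
  \<comment> \<open>The witness takes colour \<open>m\<close> from \<open>h\<close> and all other
    colours from \<open>k\<close>.\<close>
  obtain y where y: "y \<in> X" "\<And>i. i \<in> I \<Longrightarrow> i \<in> {m} \<Longrightarrow> c i y = c i h"
    "\<And>i. i \<in> I \<Longrightarrow> i \<notin> {m} \<Longrightarrow> c i y = c i k"
    using merge[OF assms(2) box_in_X[OF k], of "{m}"] by blast
  have "c i y = c i h" if "i \<in> S" for i
    using y(2,3)[of i] that assms(1) k by (cases "i = m") (auto simp: mem_box)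
  then have "y \<in> box S h" using y(1) by (auto simp: mem_box)
  moreover have "\<forall>i\<in>I - {m}. c i k = c i y" using y(3) by simp
  ultimately show "k \<in> forget m (box S h)"
    using box_in_X[OF k] by (auto simp: forget_def)
qed

lemma forget_mono: "Y \<subseteq> Z \<Longrightarrow> forget m Y \<subseteq> forget m Z"
  by (auto simp: forget_def)

lemma finite_boxes: "finite boxes"
  by (rule finite_subset[of _ "Pow X"]) (auto simp: boxes_def mem_box finite_X)

lemma below_subset_boxes: "below T g \<subseteq> boxes"
  by (auto simp: below_def boxes_def mem_box)

lemma between_subset_boxes: "S \<subseteq> I \<Longrightarrow> g \<in> X \<Longrightarrow> between T S g \<subseteq> boxes"
  unfolding between_def boxes_def by blast

section \<open>Ranks and lengths of chains of boxes\<close>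

lemma rank_box:
  assumes "S \<subseteq> I" "h \<in> X"
  shows "rank (box S h) = card S"
proof -
  have "i \<in> S" if i: "i \<in> I" and const: "\<And>y z. y \<in> box S h \<Longrightarrow> z \<in> box S h \<Longrightarrow> c i y = c i z" for i
  proof -
    have "k \<in> box {i} h" if "k \<in> box S h" for k
      using const[OF that box_self[OF assms(2)]] that by (simp add: mem_box)
    then have "box S h \<subseteq> box {i} h" by blast
    then show ?thesis using box_subset_iff[of S "{i}" h h] assms i by simp
  qed
  moreover have "c i y = c i z" if "i \<in> S" "y \<in> box S h" "z \<in> box S h" for i y z
    using that by (simp add: mem_box)
  ultimately have "{i \<in> I. \<forall>y\<in>box S h. \<forall>z\<in>box S h. c i y = c i z} = S"
    using assms(1) by blast
  then show ?thesis by (simp add: rank_def)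
qed

lemma rank_less:
  assumes "Y \<in> boxes" "Z \<in> boxes" "Y < Z"
  shows "rank Z < rank Y"
proof -
  obtain S h T g where *: "Y = box S h" "S \<subseteq> I" "h \<in> X" "Z = box T g" "T \<subseteq> I" "g \<in> X"
    using assms(1,2) by (auto simp: boxes_def)
  then have "T \<subset> S" using assms(3) box_less_iff[of S T h g] by blast
  then have "card T < card S"
    using *(2) finite_I by (intro psubset_card_mono) (auto intro: finite_subset)
  then show ?thesis using * by (simp add: rank_box)
qed

lemma chain_card_le:
  assumes "\<sigma> \<in> order_complex P" "P \<subseteq> boxes" "\<And>Y. Y \<in> P \<Longrightarrow> a < rank Y \<and> rank Y < b"
  shows "card \<sigma> \<le> b - a - 1"
proof -
  have \<sigma>: "\<sigma> \<subseteq> P" "\<And>Y Z. Y \<in> \<sigma> \<Longrightarrow> Z \<in> \<sigma> \<Longrightarrow> Y \<subseteq> Z \<or> Z \<subseteq> Y"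
    using assms(1) by (auto simp: order_complex_iff)
  have "inj_on rank \<sigma>"
  proof (rule inj_onI, rule ccontr)
    fix Y Z assume YZ: "Y \<in> \<sigma>" "Z \<in> \<sigma>" "rank Y = rank Z" "Y \<noteq> Z"
    then have "Y < Z \<or> Z < Y" using \<sigma>(2)[of Y Z] by blast
    then show False
      using rank_less[of Y Z] rank_less[of Z Y] YZ \<sigma>(1) assms(2) by auto
  qed
  then have "card \<sigma> = card (rank ` \<sigma>)" by (simp add: card_image)
  also have "\<dots> \<le> card {a<..<b}"
    using \<sigma>(1) assms(3) by (intro card_mono) auto
  finally show ?thesis by simp
qed

section \<open>Homology of the open intervals\<close>

lemma below_Int:
  assumes "T \<subseteq> T'" "T' \<subseteq> I" "h \<in> box T g"
  shows "below T g \<inter> {..<box T' h} = below T' h"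
proof (intro equalityI subsetI)
  fix Y assume "Y \<in> below T g \<inter> {..<box T' h}"
  then obtain S k where S: "Y = box S k" "T \<subset> S" "S \<subseteq> I" "k \<in> X" "box S k < box T' h"
    by (auto simp: below_def mem_box)
  then have "T' \<subset> S" "k \<in> box T' h"
    using box_less_iff[OF S(3) assms(2) S(4) box_in_X[OF assms(3)]] by blast+
  then show "Y \<in> below T' h" using S unfolding below_def by blast
next
  fix Y assume "Y \<in> below T' h"
  then obtain S k where S: "Y = box S k" "T' \<subset> S" "S \<subseteq> I" "k \<in> box T' h"
    by (auto simp: below_def)
  then have "box S k < box T' h"
    using box_less_iff[OF S(3) assms(2) box_in_X[OF S(4)] box_in_X[OF assms(3)]] by blast
  moreover have "k \<in> box T g"
    using S(4) box_subset_iff[of T' T h g] assms box_in_X[OF assms(3)] by blast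
  moreover have "T \<subset> S" using S(2) assms(1) by blast
  ultimately show "Y \<in> below T g \<inter> {..<box T' h}"
    using S(1,3) unfolding below_def by blast
qed

text \<open>
  In the picture of the join: without the vertices of colour \<open>m\<close> other than \<open>v = c m g\<close>, the
  faces retract to those avoiding these vertices (drop the vertex of colour \<open>m\<close>), and then to
  those containing \<open>v\<close> (add \<open>v\<close>).
\<close>

lemma acyclic_below_minus:
  assumes T: "T \<subseteq> I" and m: "m \<in> I - T" and g: "g \<in> X"
  shows "acyclic_poset (below T g - {box (insert m T) h | h. h \<in> box T g \<and> c m h \<noteq> c m g})"
    (is "acyclic_poset (_ - ?A)")
proof -
  let ?M = "box {m} g"
  define P0 where "P0 = below T g - ?A"
  define P1 where "P1 = {box S h | S h. T \<subset> S \<and> S \<subseteq> I \<and> h \<in> box T g \<and> (m \<in> S \<longrightarrow> c m h = c m g)}"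
  have P1I: "box S h \<in> P1"
    if "T \<subset> S" "S \<subseteq> I" "h \<in> box T g" "m \<in> S \<Longrightarrow> c m h = c m g" for S h
    using that unfolding P1_def by blast
  \<comment> \<open>Whether a box fixes colour \<open>m\<close> at a label other than that of
    \<open>g\<close> is thus visible from the set, so the map \<open>f\<close> needs no choice of
    base points. Within \<open>below T g\<close>, \<open>P1\<close> consists of the boxes that meet
    \<open>?M\<close>.\<close>
  have meet: "box S h \<inter> ?M = {} \<longleftrightarrow> m \<in> S \<and> c m h \<noteq> c m g" if S: "S \<subseteq> I" and h: "h \<in> X" for S h
  proof (cases "m \<in> S")
    case True
    then show ?thesis using h by (auto simp: mem_box)
  next
    case False
    obtain k where k: "k \<in> X" "\<And>i. i \<in> I \<Longrightarrow> i \<in> {m} \<Longrightarrow> c i k = c i g"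
      "\<And>i. i \<in> I \<Longrightarrow> i \<notin> {m} \<Longrightarrow> c i k = c i h"
      using merge[OF g h, of "{m}"] by blast
    then have "k \<in> box S h" "k \<in> ?M" using S False m unfolding mem_box by blast+
    then show ?thesis using False by blast
  qed
  have P0E: "\<exists>S h. Y = box S h \<and> T \<subset> S \<and> S \<subseteq> I \<and> h \<in> box T g \<and>
      (S = insert m T \<longrightarrow> c m h = c m g)" if "Y \<in> P0" for Y
    using that by (auto simp: P0_def below_def)
  have P1_P0: "P1 \<subseteq> P0"
  proof
    fix Y assume "Y \<in> P1"
    then obtain S h where Y: "Y = box S h" "T \<subset> S" "S \<subseteq> I" "h \<in> box T g" "m \<in> S \<longrightarrow> c m h = c m g"
      by (auto simp: P1_def)
    have "Y \<notin> ?A"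
    proof
      assume "Y \<in> ?A"
      then obtain k where k: "k \<in> box T g" "c m k \<noteq> c m g" "box S h = box (insert m T) k"
        using Y(1) by auto
      then have "S = insert m T \<and> h \<in> box (insert m T) k"
        using box_eq_iff[of S "insert m T" h k] Y T m by (auto simp: mem_box)
      then show False using Y(5) k(2) by (auto simp: mem_box)
    qed
    then show "Y \<in> P0" using Y(1) belowI[OF Y(2-4)] by (simp add: P0_def)
  qed
  have P1_meet: "Y \<inter> ?M \<noteq> {}" if "Y \<in> P1" for Y
    using that meet by (auto simp: P1_def mem_box)
  define f where "f Y = (if Y \<inter> ?M = {} then forget m Y else Y)" for Y
  have f_P1: "f Y \<in> P1" if YP: "Y \<in> P0" for Y
  proof -
    obtain S h where Y: "Y = box S h" "T \<subset> S" "S \<subseteq> I" "h \<in> box T g" "S = insert m T \<longrightarrow> c m h = c m g"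
      using P0E[OF YP] by blast
    show ?thesis
    proof (cases "Y \<inter> ?M = {}")
      case True
      then have mS: "m \<in> S" "c m h \<noteq> c m g" using meet[OF Y(3), of h] Y by (auto simp: mem_box)
      \<comment> \<open>The removal of \<open>?A\<close> is used here: a box with
        \<open>S = insert m T\<close> and a wrong label would be sent to \<open>box T g\<close>,
        outside the poset.\<close>
      then have "T \<subset> S - {m}" using Y(2,5) m by auto
      then show ?thesis
        using True Y(1) forget_box[OF Y(3) box_in_X[OF Y(4)], of m]
          P1I[OF _ _ Y(4), of "S - {m}"] Y(3) by (auto simp: f_def)
    next
      case False
      then have "m \<in> S \<Longrightarrow> c m h = c m g"
        using Y(1) meet[OF Y(3) box_in_X[OF Y(4)]] by blast
      then show ?thesis using False Y(1) P1I[OF Y(2-4)] by (simp add: f_def)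
    qed
  qed
  have f_fix: "f Y = Y" if "Y \<in> P1" for Y using P1_meet[OF that] by (simp add: f_def)
  have f_img: "f ` P0 = P1"
    using f_P1 f_fix P1_P0 by (auto simp: image_iff) (metis subsetD)
  have finP0: "finite P0"
    unfolding P0_def using below_subset_boxes finite_boxes by (meson finite_Diff finite_subset)
  have "acyclic_poset P1"
  \<comment> \<open>Intersecting with \<open>?M\<close> shrinks boxes, hence the dual order. All
    images lie in \<open>box (insert m T) g\<close>, which becomes the apex.\<close>
  proof (rule acyclic_closure[where r = "\<lambda>Y Z. Z \<le> Y" and s = "\<lambda>Y Z. Z < Y" and f = "\<lambda>Y. Y \<inter> ?M"])
    show "class.order (\<lambda>Y Z. Z \<le> Y) (\<lambda>Y Z :: 'a set. Z < Y)" by unfold_locales auto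
    show "finite P1" using P1_P0 finP0 by (rule finite_subset)
    have img: "Y \<inter> ?M \<in> P1 \<and> Y \<inter> ?M \<subseteq> box (insert m T) g" if YP: "Y \<in> P1" for Y
    proof -
      obtain S h where Y: "Y = box S h" "T \<subset> S" "S \<subseteq> I" "h \<in> box T g"
        using YP by (auto simp: P1_def)
      obtain p where p: "p \<in> Y" "p \<in> ?M" using P1_meet[OF YP] by blast
      then have "Y \<inter> ?M = box (insert m S) p" using box_Int[of p S h "{m}" g] Y(1) by simp
      moreover have "Y \<subseteq> box T g"
        using box_subset_iff[OF Y(3) T box_in_X[OF Y(4)]] Y(1,2,4) by blast
      moreover have "c m p = c m g" using p(2) by (simp add: mem_box)
      moreover have "box (insert m S) p \<in> P1"
        using Y(2,3) m p(1) calculation by (intro P1I) auto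
      ultimately show ?thesis by (auto simp: mem_box)
    qed
    then show "Y \<inter> ?M \<in> P1" if "Y \<in> P1" for Y using that by blast
    have "box (insert m T) g \<in> P1"
      using T m box_self[OF g] by (intro P1I) auto
    moreover have "box (insert m T) g \<inter> ?M = box (insert m T) g" by (auto simp: mem_box)
    ultimately have "box (insert m T) g \<in> (\<lambda>Y. Y \<inter> ?M) ` P1" by (metis image_eqI)
    then show "acyclic_poset ((\<lambda>Y. Y \<inter> ?M) ` P1)"
      using \<open>finite P1\<close> img by (intro acyclic_cone[of _ "box (insert m T) g"]) auto
  qed auto
  have "acyclic_poset P0"
  proof (rule acyclic_closure[where r = "(\<le>)" and s = "(<)" and f = f])
    show "class.order ((\<le>) :: 'a set \<Rightarrow> _) (<)" by unfold_locales
    show "f Y \<in> P0" if "Y \<in> P0" for Y using f_P1[OF that] P1_P0 by blast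
    show "f (f Y) = f Y" if "Y \<in> P0" for Y using f_P1[OF that] by (rule f_fix)
    show "acyclic_poset (f ` P0)" unfolding f_img by fact
    have X: "Y \<subseteq> X" if "Y \<in> P0" for Y using P0E[OF that] by (auto simp: mem_box)
    then have "Y \<subseteq> forget m Y" if "Y \<in> P0" for Y using that by (force simp: forget_def)
    then show "Y \<le> f Y" if "Y \<in> P0" for Y using that by (auto simp: f_def)
    show "f Y \<le> f Z" if YZ: "Y \<in> P0" "Z \<in> P0" "Y \<le> Z" for Y Z
    \<comment> \<open>In the mixed case \<open>Y\<close> is enlarged while \<open>Z\<close> is kept.
      Then \<open>Z\<close> leaves colour \<open>m\<close> free, as otherwise it would share the
      wrong label of \<open>Y\<close>; so forgetting \<open>m\<close> fixes
      \<open>Z\<close>.\<close>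
    proof (cases "Y \<inter> ?M = {} \<and> Z \<inter> ?M \<noteq> {}")
      case True
      obtain S h where Y: "Y = box S h" "S \<subseteq> I" "h \<in> X" using P0E[OF YZ(1)] by (auto simp: mem_box)
      obtain S' k where Z: "Z = box S' k" "S' \<subseteq> I" "k \<in> X" using P0E[OF YZ(2)] by (auto simp: mem_box)
      have "h \<in> box S' k" using YZ(3) Y Z box_self[of h S] by blast
      then have "m \<notin> S'" using True meet[of S h] meet[of S' k] Y Z by (auto simp: mem_box)
      then have "forget m Z = Z" using forget_box[OF Z(2,3), of m] Z(1) by simp
      then show ?thesis using True forget_mono[OF YZ(3), of m] by (simp add: f_def)
    next
      case False
      then show ?thesis using YZ(3) forget_mono[OF YZ(3), of m] by (auto simp: f_def)
    qed
  qed (use finP0 in auto)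
  then show ?thesis by (simp add: P0_def)
qed

text \<open>Induction on the number of free colours. For a free colour \<open>m\<close>, the boxes
  fixing \<open>m\<close> at a label other than that of \<open>g\<close> are put back into an
  acyclic poset, and below each of them one colour fewer is free.\<close>

theorem concentrated_below:
  assumes "T \<subseteq> I" "g \<in> X"
  shows "concentrated (below T g) (int (card (I - T)) - 1) (\<Prod>i\<in>I - T. card (c i ` X) - 1)"
  using assms
proof (induction "card (I - T)" arbitrary: T g)
  case 0
  then have *: "I - T = {}" using finite_I by simp
  then have "below T g = {}" by (auto simp: below_def)
  then show ?case using concentrated_empty unfolding * by simp
next
  case (Suc n)
  have fin: "finite T" using Suc.prems(1) finite_I by (rule finite_subset)
  have "I - T \<noteq> {}" using Suc.hyps(2) by force
  then obtain m where m: "m \<in> I - T" by blast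
  define T' where "T' = insert m T"
  have T': "T' \<subseteq> I" "T \<subseteq> T'" using m Suc.prems(1) by (auto simp: T'_def)
  have IT: "I - T = insert m (I - T')" "m \<notin> I - T'" using m by (auto simp: T'_def)
  have cardIT: "card (I - T) = Suc (card (I - T'))" using IT finite_I by simp
  define A where "A = {box T' h | h. h \<in> box T g \<and> c m h \<noteq> c m g}"
  let ?P = "\<Prod>i\<in>I - T'. card (c i ` X) - 1"
  have "\<exists>h. h \<in> box T g \<and> c m h = l" if lX: "l \<in> c m ` X" for l
  proof -
    obtain h where h: "h \<in> X" "l = c m h" using lX by blast
    obtain k where k: "k \<in> X" "\<And>i. i \<in> I \<Longrightarrow> i \<in> {m} \<Longrightarrow> c i k = c i h"
      "\<And>i. i \<in> I \<Longrightarrow> i \<notin> {m} \<Longrightarrow> c i k = c i g"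
      using merge[OF h(1) Suc.prems(2), of "{m}"] by blast
    have "c i k = c i g" if "i \<in> T" for i
      using that m Suc.prems(1) by (intro k(3)) auto
    then have "k \<in> box T g" using k(1) by (simp add: mem_box)
    moreover have "c m k = l" using k(2)[of m] m h(2) by simp
    ultimately show ?thesis by blast
  qed
  then have "\<forall>l\<in>c m ` X. \<exists>h. h \<in> box T g \<and> c m h = l" by blast
  \<comment> \<open>Each label of colour \<open>m\<close> occurs inside \<open>box T g\<close>; one
    representative per label lets the boxes of \<open>A\<close> be counted by labels.\<close>
  from bchoice[OF this] obtain rep
    where rep: "\<And>l. l \<in> c m ` X \<Longrightarrow> rep l \<in> box T g \<and> c m (rep l) = l" by blast
  let ?L = "c m ` X - {c m g}"
  have "A = (\<lambda>l. box T' (rep l)) ` ?L"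
  proof (intro equalityI subsetI)
    fix Y assume "Y \<in> A"
    then obtain h where h: "Y = box T' h" "h \<in> box T g" "c m h \<noteq> c m g" by (auto simp: A_def)
    then have l: "c m h \<in> c m ` X" by (auto simp: mem_box)
    with h(2) rep[OF l] have "rep (c m h) \<in> box T' h" by (simp add: mem_box T'_def)
    from box_cong[OF this] have "Y = box T' (rep (c m h))" using h(1) by simp
    then show "Y \<in> (\<lambda>l. box T' (rep l)) ` ?L" using l h(3) by (intro image_eqI) auto
  next
    fix Y assume "Y \<in> (\<lambda>l. box T' (rep l)) ` ?L"
    then obtain l where l: "l \<in> c m ` X" "l \<noteq> c m g" "Y = box T' (rep l)" by blast
    with rep[OF l(1)] show "Y \<in> A" by (auto simp: A_def)
  qed
  moreover have "inj_on (\<lambda>l. box T' (rep l)) ?L"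
  proof (rule inj_onI)
    fix l l' assume l: "l \<in> ?L" "l' \<in> ?L" "box T' (rep l) = box T' (rep l')"
    then have "rep l \<in> box T' (rep l')"
      using rep[of l] box_self[of "rep l" T'] by (auto dest: box_in_X)
    then have "c m (rep l) = c m (rep l')" by (simp add: mem_box T'_def)
    then show "l = l'" using rep[of l] rep[of l'] l(1,2) by simp
  qed
  ultimately have cardA: "card A = card (c m ` X) - 1"
    using Suc.prems(2) finite_X by (simp add: card_image)
  have "concentrated (below T g) (int (card (I - T)) - 1) (0 + card A * ?P)"
  proof (rule concentrated_add_maximals)
    show finb: "finite (below T g)" using below_subset_boxes finite_boxes by (rule finite_subset)
    show sub: "A \<subseteq> below T g" using T' m by (auto simp: A_def below_def T'_def)
    then show "finite A" using finb finite_subset by blast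
    show "\<not> Y < Z" if Y: "Y \<in> A" and Z: "Z \<in> below T g" for Y Z
    proof
      assume "Y < Z"
      obtain h where h: "Y = box T' h" "h \<in> X" using Y by (auto simp: A_def mem_box)
      obtain S k where S: "Z = box S k" "T \<subset> S" "S \<subseteq> I" "k \<in> X" using Z by (auto simp: below_def mem_box)
      have "S \<subset> T'" using \<open>Y < Z\<close> box_less_iff[OF T'(1) S(3) h(2) S(4)] h(1) S(1) by simp
      with S(2) show False by (auto simp: T'_def)
    qed
    show "concentrated (below T g - A) (int (card (I - T)) - 1) 0"
    proof (rule acyclic_concentrated)
      show "acyclic_poset (below T g - A)"
        using acyclic_below_minus[OF Suc.prems(1) m Suc.prems(2)] by (simp add: A_def T'_def)
      fix \<sigma> assume \<sigma>: "\<sigma> \<in> order_complex (below T g - A)"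
      \<comment> \<open>The ranks run up to \<open>card I\<close> inclusive, the rank of boxes with
        all colours fixed; hence \<open>Suc (card I)\<close> as the open upper end.\<close>
      have "card \<sigma> \<le> Suc (card I) - card T - 1"
      proof (rule chain_card_le[OF \<sigma>])
        fix Y assume "Y \<in> below T g - A"
        then obtain S h where S: "Y = box S h" "T \<subset> S" "S \<subseteq> I" "h \<in> X"
          by (auto simp: below_def mem_box)
        then have "finite S" using finite_I finite_subset by blast
        then show "card T < rank Y \<and> rank Y < Suc (card I)"
          using S finite_I by (simp add: rank_box less_Suc_eq_le psubset_card_mono card_mono)
      qed (use below_subset_boxes in blast)
      then show "int (card \<sigma>) \<le> int (card (I - T)) - 1 + 1"
        using Suc.prems(1) fin by (simp add: card_Diff_subset)
    qed
    show "concentrated (below T g \<inter> {..<Y}) (int (card (I - T)) - 1 - 1) ?P" if YA: "Y \<in> A" for Y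
    proof -
      obtain h where h: "Y = box T' h" "h \<in> box T g" using YA by (auto simp: A_def)
      have "concentrated (below T' h) (int (card (I - T')) - 1) ?P"
        using Suc.hyps(2) cardIT T'(1) box_in_X[OF h(2)] by (intro Suc.hyps(1)) auto
      then show ?thesis using below_Int[OF T'(2,1) h(2)] h(1) cardIT by simp
    qed
  qed
  moreover have "card A * ?P = (\<Prod>i\<in>I - T. card (c i ` X) - 1)"
    using IT finite_I by (simp add: cardA)
  ultimately show ?case by simp
qed

lemma between_Int:
  assumes "T \<subset> T'" "T' \<subset> S" "S \<subseteq> I" "g \<in> X"
  shows "between T S g \<inter> {..<box T' g} = between T' S g"
proof -
  have less: "box U g < box T' g \<longleftrightarrow> T' \<subset> U" if "U \<subset> S" for U
    using box_less_iff[of U T' g g] that assms by (auto simp: mem_box)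
  show ?thesis
  proof (intro equalityI subsetI)
    fix Y assume Y: "Y \<in> between T S g \<inter> {..<box T' g}"
    then obtain U where "Y = box U g" "U \<subset> S" unfolding between_def by blast
    then show "Y \<in> between T' S g" using Y less by (simp add: betweenI)
  next
    fix Y assume "Y \<in> between T' S g"
    then obtain U where U: "Y = box U g" "T' \<subset> U" "U \<subset> S" unfolding between_def by blast
    with assms(1) have "T \<subset> U" by (meson psubset_trans)
    with U show "Y \<in> between T S g \<inter> {..<box T' g}" using less by (simp add: betweenI)
  qed
qed

text \<open>The proper part of a Boolean lattice of rank r is a sphere of dimension r - 2. Deleting
  one maximal element leaves an acyclic poset, and below that element lies the proper part for rank
  r - 1; rank one gives the empty poset.\<close>

theorem concentrated_between:
  assumes "T \<subset> S" "S \<subseteq> I" "g \<in> X"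
  shows "concentrated (between T S g) (int (card (S - T)) - 2) 1"
  using assms
proof (induction "card (S - T)" arbitrary: T)
  case 0
  have "finite S" using assms(2) finite_I by (rule finite_subset)
  with 0 show ?case by auto
next
  case (Suc n)
  have fin: "finite S" "finite T" using Suc.prems assms(2) finite_I by (meson finite_subset psubset_imp_subset)+
  obtain m where m: "m \<in> S - T" using Suc.prems(1) by blast
  define T' where "T' = insert m T"
  have ST: "S - T = insert m (S - T')" "m \<notin> S - T'" using m by (auto simp: T'_def)
  have cardST: "card (S - T) = Suc (card (S - T'))" using ST fin by simp
  have TT': "T \<subset> T'" using m by (auto simp: T'_def)
  have bound: "int (card \<sigma>) \<le> int (card (S - T)) - 2 + 1"
    if \<sigma>: "\<sigma> \<in> order_complex P" and P: "P \<subseteq> between T S g" for \<sigma> P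
  proof -
    have "card \<sigma> \<le> card S - card T - 1"
    proof (rule chain_card_le[OF \<sigma>])
      fix Y assume "Y \<in> P"
      then obtain U where U: "Y = box U g" "T \<subset> U" "U \<subset> S"
        using P unfolding between_def by blast
      then have "finite U" "U \<subseteq> I" using fin(1) Suc.prems(2) finite_subset by blast+
      then show "card T < rank Y \<and> rank Y < card S"
        using U fin(1) Suc.prems(3) by (simp add: rank_box psubset_card_mono)
    qed (use P between_subset_boxes[OF Suc.prems(2,3)] in blast)
    moreover have "card (S - T) = card S - card T" using fin Suc.prems(1) by (simp add: card_Diff_subset)
    ultimately show ?thesis using cardST by simp
  qed
  show ?case
  proof (cases "T' = S")
    case True
    then have "between T S g = {}" unfolding between_def T'_def by blast
    moreover have "int (card (S - T)) - 2 = -1" using cardST True by simp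
    ultimately show ?thesis using concentrated_empty by simp
  next
    case False
    then have T'S: "T' \<subset> S" using m Suc.prems(1) unfolding T'_def by blast
    define P where "P = between T S g - {box T' g}"
    have PE: "\<exists>U. Y = box U g \<and> T \<subset> U \<and> U \<subset> S \<and> U \<noteq> T'" if "Y \<in> P" for Y
      using that unfolding P_def between_def by blast
    have PI: "box U g \<in> P" if "T \<subset> U" "U \<subset> S" "U \<noteq> T'" for U
    proof -
      have "U \<subseteq> I" "T' \<subseteq> I" using that(2) T'S Suc.prems(2) by blast+
      then show ?thesis
        using betweenI[OF that(1,2)] that(3) box_eq_iff[of U T' g g] Suc.prems(3)
        by (simp add: P_def)
    qed
    have finb: "finite (between T S g)"
      using between_subset_boxes[OF Suc.prems(2,3)] finite_boxes by (rule finite_subset)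
    have forget: "forget m (box U g) = box (U - {m}) g" if "U \<subset> S" for U
      using that Suc.prems(2,3) by (intro forget_box) auto
    have "acyclic_poset P"
    proof (rule acyclic_closure[where r = "(\<le>)" and s = "(<)" and f = "forget m"])
      show "class.order ((\<le>) :: 'a set \<Rightarrow> _) (<)" by unfold_locales
      show "finite P" using finb by (simp add: P_def)
      have img: "forget m Y \<in> P \<and> box (S - {m}) g \<subseteq> forget m Y \<and> Y \<subseteq> forget m Y \<and>
          forget m (forget m Y) = forget m Y" if YP: "Y \<in> P" for Y
      proof -
        obtain U where U: "Y = box U g" "T \<subset> U" "U \<subset> S" "U \<noteq> T'" using PE[OF YP] by blast
        \<comment> \<open>Forgetting \<open>m\<close> stays above \<open>T\<close> because the one
          set that would fall to \<open>T\<close>, namely \<open>T'\<close>, was removed. Every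
          image contains \<open>box (S - {m}) g\<close>, the apex.\<close>
        have U': "T \<subset> U - {m}" "U - {m} \<subset> S" "U - {m} \<noteq> T'" using U(2-4) m unfolding T'_def by blast+
        have "box (S - {m}) g \<subseteq> box (U - {m}) g" "box U g \<subseteq> box (U - {m}) g"
          using U(3) unfolding box_def by blast+
        then show ?thesis
          using PI[OF U'] U(1) forget[OF U(3)] forget[OF U'(2)] by simp
      qed
      then show "forget m Y \<in> P" "Y \<le> forget m Y" "forget m (forget m Y) = forget m Y"
        if "Y \<in> P" for Y using that by auto
      have "T \<subset> S - {m}" "S - {m} \<subset> S" "S - {m} \<noteq> T'"
        using T'S m unfolding T'_def by blast+
      then have "box (S - {m}) g \<in> P" by (rule PI)
      moreover have "forget m (box (S - {m}) g) = box (S - {m}) g" using forget[of "S - {m}"] m by fastforce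
      ultimately have "box (S - {m}) g \<in> forget m ` P" by (metis image_eqI)
      then show "acyclic_poset (forget m ` P)"
        using \<open>finite P\<close> img by (intro acyclic_cone[of _ "box (S - {m}) g"]) auto
    qed (simp, rule forget_mono)
    then have "concentrated P (int (card (S - T)) - 2) 0"
      by (rule acyclic_concentrated) (rule bound, auto simp: P_def)
    moreover have "concentrated (between T S g \<inter> {..<box T' g}) (int (card (S - T)) - 2 - 1) 1"
      using Suc.hyps(1)[of T'] Suc.hyps(2) Suc.prems cardST T'S between_Int[OF TT' T'S Suc.prems(2,3)]
      by simp
    moreover have "\<not> box T' g < Y" if Y: "Y \<in> between T S g" for Y
    proof
      assume less: "box T' g < Y"
      obtain U where U: "Y = box U g" "T \<subset> U" "U \<subset> S" using Y unfolding between_def by blast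
      then have "U \<subset> T'"
        using less box_less_iff[of T' U g g] T'S Suc.prems(2,3) by blast
      with U(2) show False unfolding T'_def by blast
    qed
    moreover have "box T' g \<in> between T S g" using TT' T'S by (rule betweenI)
    ultimately have "concentrated (between T S g) (int (card (S - T)) - 2) (0 + 1)"
      using finb by (intro concentrated_add_maximal[of _ "box T' g"]) (auto simp: P_def)
    then show ?thesis by simp
  qed
qed

theorem cohen_macaulay_boxes: "cohen_macaulay (insert {} boxes)"
proof -
  let ?Q = "insert {} boxes"
  obtain g0 where g0: "g0 \<in> X" using X_nonempty by blast
  have nonempty: "Y \<noteq> {}" if "Y \<in> boxes" for Y
    using that box_self by (force simp: boxes_def)
  have X: "box {} g0 = X" by (auto simp: mem_box)
  have "graded_poset ?Q"
  \<comment> \<open>All colours are vacuously constant on the empty set, so \<open>rank {}\<close>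
    would be \<open>card I\<close>, the same as for the smallest boxes. The bottom therefore gets
    the next value explicitly.\<close>
  proof (rule graded_posetI[where b = "{}" and t = "box {} g0" and N = "Suc (card I)"
        and \<rho> = "\<lambda>Y. if Y = {} then Suc (card I) else rank Y"])
    show "finite ?Q" using finite_boxes by simp
    show "box {} g0 \<in> ?Q" using g0 by (auto simp: boxes_def)
    show "Y \<le> box {} g0" if "Y \<in> ?Q" for Y using that unfolding X by (auto simp: boxes_def mem_box)
    show "(if box {} g0 = {} then Suc (card I) else rank (box {} g0)) = 0"
      using rank_box[of "{}" g0] g0 X X_nonempty by simp
    have le: "rank Y < Suc (card I)" if "Y \<in> boxes" for Y
      using that finite_I by (auto simp: boxes_def rank_box less_Suc_eq_le intro: card_mono)
    show "(if Z = {} then Suc (card I) else rank Z) < (if Y = {} then Suc (card I) else rank Y)"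
      if "Y \<in> ?Q" "Z \<in> ?Q" "Y < Z" for Y Z
      using that rank_less[of Y Z] le[of Z] nonempty by auto
    show "\<exists>W\<in>?Q. Y < W \<and> W < Z" if Y: "Y \<in> ?Q" and Z: "Z \<in> ?Q" and less: "Y < Z"
      and gap: "(if Z = {} then Suc (card I) else rank Z) + 1 <
        (if Y = {} then Suc (card I) else rank Y)" for Y Z
    proof -
      have "Z \<in> boxes" using Z less by auto
      then obtain T g where T: "Z = box T g" "T \<subseteq> I" "g \<in> X" by (auto simp: boxes_def)
      have rZ: "(if Z = {} then Suc (card I) else rank Z) = card T"
        using nonempty[OF \<open>Z \<in> boxes\<close>] T by (simp add: rank_box)
      show ?thesis
      proof (cases "Y = {}")
        case True
        then have "T \<noteq> I" using gap rZ by auto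
        then obtain m where "m \<in> I - T" using T(2) by blast
        then have "insert m T \<subseteq> I" "T \<subset> insert m T" using T(2) by blast+
        then have "box (insert m T) g \<in> boxes" "box (insert m T) g < Z"
          using T box_less_iff[of "insert m T" T g g] box_self boxesI by simp_all
        then show ?thesis using True nonempty by (metis bot.not_eq_extremum insertI2)
      next
        case False
        then obtain S h where S: "Y = box S h" "S \<subseteq> I" "h \<in> X" using Y by (auto simp: boxes_def)
        have hT: "T \<subset> S" "h \<in> box T g" using box_less_iff[OF S(2) T(2) S(3) T(3)] less S(1) T(1) by auto
        then obtain m where m: "m \<in> S - T" by blast
        have "card S > card T + 1" using gap rZ False S by (simp add: rank_box)
        then have "insert m T \<noteq> S"
          using m finite_subset[OF T(2) finite_I] by (auto simp: card_insert_if)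
        then have sub: "insert m T \<subset> S" using m hT by blast
        then have "insert m T \<subseteq> I" "T \<subset> insert m T" using S(2) m by blast+
        then have "box (insert m T) h \<in> boxes" "Y < box (insert m T) h" "box (insert m T) h < Z"
          using S T hT(2) sub box_less_iff[of S "insert m T" h h] box_less_iff[of "insert m T" T h g]
            box_self boxesI by simp_all
        then show ?thesis by blast
      qed
    qed
  qed auto
  \<comment> \<open>Concentration in any degree will do: \<open>concentrated_betti\<close> turns it
    into vanishing below the actual dimension of the interval.\<close>
  moreover have "\<exists>d k. concentrated (?Q \<inter> {Y<..<Z}) d k" if Y: "Y \<in> ?Q" and Z: "Z \<in> ?Q" and less: "Y < Z" for Y Z
  proof -
    have "Z \<in> boxes" using Z less by auto
    then obtain T g where T: "Z = box T g" "T \<subseteq> I" "g \<in> X" by (auto simp: boxes_def)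
    show ?thesis
    proof (cases "Y = {}")
      case True
      have "?Q \<inter> {Y<..<Z} = below T g"
      proof (intro equalityI subsetI)
        fix W assume W: "W \<in> ?Q \<inter> {Y<..<Z}"
        then have "W \<in> boxes" using True by auto
        then obtain S h where S: "W = box S h" "S \<subseteq> I" "h \<in> X" by (auto simp: boxes_def)
        then show "W \<in> below T g" using W T box_less_iff[OF S(2) T(2) S(3) T(3)] by (auto simp: below_def)
      next
        fix W assume W: "W \<in> below T g"
        then obtain S h where S: "W = box S h" "S \<subseteq> I" "h \<in> X" "T \<subset> S" "h \<in> box T g"
          by (auto simp: below_def mem_box)
        then have "W < Z" using T box_less_iff[OF S(2) T(2) S(3) T(3)] by auto
        then show "W \<in> ?Q \<inter> {Y<..<Z}"
          using W below_subset_boxes[of T g] nonempty[of W] True by auto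
      qed
      then show ?thesis using concentrated_below[OF T(2,3)] by auto
    next
      case False
      then obtain S h where S: "Y = box S h" "S \<subseteq> I" "h \<in> X" using Y by (auto simp: boxes_def)
      have hT: "T \<subset> S" "h \<in> box T g" using box_less_iff[OF S(2) T(2) S(3) T(3)] less S(1) T(1) by auto
      have "?Q \<inter> {Y<..<Z} = between T S h"
      proof (intro equalityI subsetI)
        fix W assume W: "W \<in> ?Q \<inter> {Y<..<Z}"
        then have "W \<in> boxes" by auto
        then obtain U k where U: "W = box U k" "U \<subseteq> I" "k \<in> X" by (auto simp: boxes_def)
        have "U \<subset> S" "h \<in> box U k" using W S U box_less_iff[OF S(2) U(2) S(3) U(3)] by auto
        moreover have "T \<subset> U" using W T U box_less_iff[OF U(2) T(2) U(3) T(3)] by auto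
        ultimately show "W \<in> between T S h" using U(1) box_cong[of h U k] by (auto simp: between_def)
      next
        fix W assume W: "W \<in> between T S h"
        then obtain U where U: "W = box U h" "T \<subset> U" "U \<subset> S" by (auto simp: between_def)
        then have "U \<subseteq> I" using S(2) by blast
        then have "Y < W" "W < Z"
          using U S T hT box_less_iff[of S U h h] box_less_iff[of U T h g] box_self[OF S(3)] by auto
        then show "W \<in> ?Q \<inter> {Y<..<Z}"
          using W between_subset_boxes[OF S(2,3), of T] by auto
      qed
      then show ?thesis using concentrated_between[OF hT(1) S(2,3)] by auto
    qed
  qed
  ultimately show ?thesis
    unfolding cohen_macaulay_def using concentrated_betti(2) by metis
qed

end

section \<open>Group-complemented Boolean intervals\<close>

locale group_complemented_boolean = group G for G (structure) +
  fixes H :: "'a set" and N :: nat and f :: "'a set \<Rightarrow> nat set"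
  assumes finite_G: "finite (carrier G)" and subgroup_H: "subgroup H G"
    and bij_f: "bij_betw f (subgroup_interval G H) (Pow {..<N})"
    and f_le_iff: "\<And>K L. K \<in> subgroup_interval G H \<Longrightarrow> L \<in> subgroup_interval G H \<Longrightarrow>
      K \<subseteq> L \<longleftrightarrow> f K \<subseteq> f L"
    and complemented: "group_complemented G H"
begin

abbreviation interval :: "'a set set" where "interval \<equiv> subgroup_interval G H"

definition subgroup_of :: "nat set \<Rightarrow> 'a set" where
  "subgroup_of = inv_into interval f"

text \<open>For \<open>i\<close> outside \<open>{..<N}\<close> this is the whole group, so the facts
  collected in \<open>coatom\<close> hold for every \<open>i\<close>; properness needs
  \<open>i < N\<close>.\<close>

definition coatom :: "nat \<Rightarrow> 'a set" where
  "coatom i = subgroup_of ({..<N} - {i})"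

section \<open>The lattice isomorphism, coatoms and their complements\<close>

lemma intervalD: "K \<in> interval \<Longrightarrow> subgroup K G" "K \<in> interval \<Longrightarrow> H \<subseteq> K"
  by (auto simp: subgroup_interval_def)

lemma interval_subset: "K \<in> interval \<Longrightarrow> K \<subseteq> carrier G"
  using intervalD(1) subgroup.subset by blast

lemma H_interval: "H \<in> interval" and carrier_interval: "carrier G \<in> interval"
  using subgroup_H subgroup.subset[OF subgroup_H] subgroup_self by (auto simp: subgroup_interval_def)

lemma f_subset: "K \<in> interval \<Longrightarrow> f K \<subseteq> {..<N}"
  using bij_betwE[OF bij_f] by blast

lemma subgroup_of:
  assumes "S \<subseteq> {..<N}"
  shows "subgroup_of S \<in> interval" "f (subgroup_of S) = S"
  using assms bij_f unfolding subgroup_of_def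
  by (auto simp: bij_betw_def intro!: inv_into_into f_inv_into_f)

lemma subgroup_of_single:
  assumes "i < N"
  shows "subgroup_of {i} \<in> interval" "f (subgroup_of {i}) = {i}"
  by (intro subgroup_of; use assms in simp)+

lemma subgroup_of_f: "K \<in> interval \<Longrightarrow> subgroup_of (f K) = K"
  unfolding subgroup_of_def using bij_f by (simp add: bij_betw_inv_into_left)

lemma subgroup_of_mono: "S \<subseteq> T \<Longrightarrow> T \<subseteq> {..<N} \<Longrightarrow> subgroup_of S \<subseteq> subgroup_of T"
  using subgroup_of[of S] subgroup_of[of T] f_le_iff by (metis subset_trans)

lemma f_H: "f H = {}"
proof -
  have "H \<subseteq> subgroup_of {}" using intervalD(2) subgroup_of(1) by blast
  then show ?thesis
    using f_le_iff[OF H_interval, of "subgroup_of {}"] subgroup_of[of "{}"] by simp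
qed

lemma f_carrier: "f (carrier G) = {..<N}"
proof -
  have "subgroup_of {..<N} \<subseteq> carrier G" using interval_subset subgroup_of(1) by blast
  then have "{..<N} \<subseteq> f (carrier G)"
    using f_le_iff[OF _ carrier_interval, of "subgroup_of {..<N}"] subgroup_of[of "{..<N}"] by simp
  then show ?thesis using f_subset[OF carrier_interval] by blast
qed

lemma coatom:
  shows "coatom i \<in> interval" "f (coatom i) = {..<N} - {i}" "subgroup (coatom i) G"
    "coatom i \<subseteq> carrier G"
  using subgroup_of[of "{..<N} - {i}"] intervalD(1) interval_subset by (auto simp: coatom_def)

lemma coatom_neq_carrier: "i < N \<Longrightarrow> coatom i \<noteq> carrier G"
  using coatom(2)[of i] f_carrier by (metis Diff_iff lessThan_iff singletonI)

lemma le_coatom_iff: "K \<in> interval \<Longrightarrow> K \<subseteq> coatom i \<longleftrightarrow> i \<notin> f K"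
  using f_le_iff[OF _ coatom(1), of K i] f_subset[of K] coatom(2)[of i] by auto

text \<open>The intersection of the coatoms indexed by \<open>T\<close> is again in the interval,
  and its image under \<open>f\<close> avoids \<open>T\<close>; so it lies in the largest such
  subgroup, which in turn lies in each of these coatoms.\<close>

lemma subgroup_of_Diff_eq:
  assumes "T \<subseteq> {..<N}" "x \<in> carrier G"
  shows "x \<in> subgroup_of ({..<N} - T) \<longleftrightarrow> (\<forall>i\<in>T. x \<in> coatom i)"
proof
  assume x: "x \<in> subgroup_of ({..<N} - T)"
  show "\<forall>i\<in>T. x \<in> coatom i"
  proof
    fix i assume "i \<in> T"
    then have "subgroup_of ({..<N} - T) \<subseteq> coatom i"
      unfolding coatom_def by (intro subgroup_of_mono) auto
    then show "x \<in> coatom i" using x by blast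
  qed
next
  assume x: "\<forall>i\<in>T. x \<in> coatom i"
  define K where "K = {y \<in> carrier G. \<forall>i\<in>T. y \<in> coatom i}"
  have "subgroup K G"
  proof (rule subgroupI)
    show "K \<noteq> {}" using subgroup.one_closed[OF coatom(3)] by (auto simp: K_def)
  qed (auto simp: K_def subgroup.m_inv_closed[OF coatom(3)] subgroup.m_closed[OF coatom(3)])
  moreover have "H \<subseteq> K"
    using intervalD(2)[OF coatom(1)] subgroup.subset[OF subgroup_H] by (auto simp: K_def)
  ultimately have K: "K \<in> interval" by (simp add: subgroup_interval_def)
  have "i \<notin> f K" if "i \<in> T" for i
    using le_coatom_iff[OF K, of i] that by (auto simp: K_def)
  then have "f K \<subseteq> {..<N} - T" using f_subset[OF K] by blast
  then have "K \<subseteq> subgroup_of ({..<N} - T)"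
    using f_le_iff[OF K subgroup_of(1)] subgroup_of(2) by (metis Diff_subset)
  then show "x \<in> subgroup_of ({..<N} - T)" using x assms(2) by (auto simp: K_def)
qed

lemma generate_interval:
  assumes "X \<subseteq> carrier G" "H \<subseteq> generate G X"
  shows "generate G X \<in> interval"
  using assms generate_is_subgroup by (simp add: subgroup_interval_def)

text \<open>For uniqueness: a complement \<open>L\<close> is not contained in the coatom, so
  \<open>i\<close> belongs to \<open>f L\<close>. Any further index of \<open>f L\<close> would give
  an atom inside both \<open>L\<close> and the coatom, hence inside \<open>H\<close>.\<close>

lemma lattice_complement_coatom:
  assumes "i < N"
  shows "lattice_complement G H (coatom i) = subgroup_of {i}"
  unfolding lattice_complement_def
proof (rule the_equality)
  let ?A = "subgroup_of {i}"
  have A: "?A \<in> interval" "f ?A = {i}" using subgroup_of_single[OF assms] .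
  let ?K = "generate G (coatom i \<union> ?A)"
  have sub: "coatom i \<union> ?A \<subseteq> ?K" by (rule subsetI) (rule generate.incl)
  have K: "?K \<in> interval"
  proof (rule generate_interval)
    show "coatom i \<union> ?A \<subseteq> carrier G" using interval_subset[OF A(1)] coatom(4) by simp
    show "H \<subseteq> ?K" using sub intervalD(2)[OF A(1)] by blast
  qed
  have "coatom i \<subseteq> ?K" "?A \<subseteq> ?K" using sub by blast+
  then have "{..<N} - {i} \<subseteq> f ?K" "{i} \<subseteq> f ?K"
    unfolding f_le_iff[OF coatom(1) K] f_le_iff[OF A(1) K] coatom(2) A(2) .
  then have "f ?K = f (carrier G)" using f_subset[OF K] f_carrier by blast
  then have "?K = carrier G" using subgroup_of_f[OF K] subgroup_of_f[OF carrier_interval] by metis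
  moreover have "coatom i \<inter> ?A = H"
  proof -
    have I: "coatom i \<inter> ?A \<in> interval"
      using subgroups_Inter_pair[OF coatom(3) intervalD(1)[OF A(1)]]
        intervalD(2)[OF coatom(1)] intervalD(2)[OF A(1)]
      unfolding subgroup_interval_def by blast
    then have "f (coatom i \<inter> ?A) \<subseteq> {..<N} - {i}" "f (coatom i \<inter> ?A) \<subseteq> {i}"
      using f_le_iff[OF I coatom(1), of i] f_le_iff[OF I A(1)] coatom(2) A(2) by simp_all
    then have "f (coatom i \<inter> ?A) = f H" using f_H by blast
    then show ?thesis using subgroup_of_f[OF I] subgroup_of_f[OF H_interval] by simp
  qed
  ultimately show "?A \<in> interval \<and> ?K = carrier G \<and> coatom i \<inter> ?A = H" using A by blast
next
  fix L assume L: "L \<in> interval \<and> generate G (coatom i \<union> L) = carrier G \<and> coatom i \<inter> L = H"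
  have "i \<in> f L"
  proof (rule ccontr)
    assume "i \<notin> f L"
    then have "coatom i \<union> L \<subseteq> coatom i" using le_coatom_iff L by blast
    then have "generate G (coatom i \<union> L) \<subseteq> coatom i"
      using generate_subgroup_incl coatom(3) by blast
    then show False using L coatom(4)[of i] coatom_neq_carrier[OF assms] by blast
  qed
  moreover have "j = i" if j: "j \<in> f L" for j
  proof (rule ccontr)
    assume "j \<noteq> i"
    have jN: "j < N" using j f_subset L by blast
    then have J: "subgroup_of {j} \<in> interval" "f (subgroup_of {j}) = {j}"
      using subgroup_of_single by blast+
    have "subgroup_of {j} \<subseteq> L" using f_le_iff[OF J(1), of L] J(2) L j by simp
    moreover have "subgroup_of {j} \<subseteq> coatom i"
      using le_coatom_iff[OF J(1), of i] J(2) \<open>j \<noteq> i\<close> by simp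
    ultimately have "subgroup_of {j} \<subseteq> H" using L by blast
    then show False using f_le_iff[OF J(1) H_interval] J(2) f_H by simp
  qed
  ultimately have "f L = {i}" by blast
  then show "L = subgroup_of {i}" using subgroup_of_f L by metis
qed

text \<open>A Chinese remainder argument, one coatom at a time. If \<open>h\<close> is right for the
  indices below \<open>k\<close>, it is multiplied on the left by an element \<open>a\<close> of the
  \<open>k\<close>-th atom. The other coatoms contain that atom, so the earlier cosets stay; the
  factorization of \<open>g \<otimes> inv h\<close> as coatom times atom supplies the
  \<open>a\<close> that reaches the coset of \<open>g\<close>.\<close>

lemma realize_cosets:
  assumes "\<And>i. i < N \<Longrightarrow> \<phi> i \<in> (\<lambda>g. coatom i #> g) ` carrier G" "k \<le> N"
  shows "\<exists>h\<in>carrier G. \<forall>i<k. coatom i #> h = \<phi> i"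
  using assms(2)
proof (induction k)
  case 0
  then show ?case by auto
next
  case (Suc k)
  then obtain h where h: "h \<in> carrier G" "\<And>i. i < k \<Longrightarrow> coatom i #> h = \<phi> i" by auto
  obtain g where g: "g \<in> carrier G" "\<phi> k = coatom k #> g" using assms(1)[of k] Suc.prems by auto
  let ?A = "subgroup_of {k}"
  have A: "?A \<in> interval" "f ?A = {k}" using subgroup_of_single[of k] Suc.prems by simp_all
  have "coatom k <#> ?A = carrier G"
    using complemented coatom(1)[of k] lattice_complement_coatom[of k] Suc.prems
    by (auto simp: group_complemented_def)
  then have "g \<otimes> inv h \<in> coatom k <#> ?A" using g h by simp
  then obtain m a where ma: "m \<in> coatom k" "a \<in> ?A" "g \<otimes> inv h = m \<otimes> a"
    by (auto simp: set_mult_def)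
  have cl: "m \<in> carrier G" "a \<in> carrier G" using ma coatom(4) interval_subset[OF A(1)] by auto
  have "g = g \<otimes> inv h \<otimes> h" using g h by (simp add: m_assoc)
  then have "g = m \<otimes> (a \<otimes> h)" using ma(3) cl h(1) by (simp add: m_assoc)
  then have "coatom k #> (a \<otimes> h) = coatom k #> g"
    using coset_mult_assoc[OF coatom(4) cl(1), of "a \<otimes> h" k] coset_join2[OF cl(1) coatom(3) ma(1)]
      cl h(1) by simp
  moreover have "coatom i #> (a \<otimes> h) = coatom i #> h" if "i < k" for i
  proof -
    have "?A \<subseteq> coatom i" using le_coatom_iff[OF A(1), of i] A(2) that by simp
    then have "coatom i #> a = coatom i" using ma(2) by (intro coset_join2 cl coatom(3)) auto
    then show ?thesis using coset_mult_assoc[OF coatom(4) cl(2) h(1), of i] by simp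
  qed
  ultimately show ?case
    using h g cl by (intro bexI[of _ "a \<otimes> h"]) (auto simp: less_Suc_eq)
qed

lemma coset_eq_iff:
  assumes "subgroup K G" "h \<in> carrier G" "g \<in> carrier G"
  shows "K #> h = K #> g \<longleftrightarrow> h \<otimes> inv g \<in> K"
proof -
  have "K #> h = K #> g \<longleftrightarrow> h \<in> K #> g"
    using assms repr_independence[of h K g] rcos_self[of h K] by auto
  also have "\<dots> \<longleftrightarrow> h \<otimes> inv g \<in> K"
    using subgroup.rcos_module[OF assms(1) is_group assms(3,2)] .
  finally show ?thesis .
qed

lemma coatom_coset_eq: "g \<in> carrier G \<Longrightarrow> coatom i #> g = coatom i \<longleftrightarrow> g \<in> coatom i"
  using coset_eq_iff[OF coatom(3), of g \<one> i] coatom(4) by simp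

section \<open>Cosets as boxes\<close>

sublocale box_system "carrier G" "{..<N}" "\<lambda>i g. coatom i #> g"
proof
  show "\<exists>h\<in>carrier G. \<forall>i\<in>{..<N}. coatom i #> h = \<phi> i"
    if "\<And>i. i \<in> {..<N} \<Longrightarrow> \<phi> i \<in> (\<lambda>g. coatom i #> g) ` carrier G" for \<phi>
    using realize_cosets[of \<phi> N] that by (simp add: Ball_def)
  fix i g assume i: "i \<in> {..<N}" and g: "g \<in> carrier G"
  then obtain a where a: "a \<in> carrier G" "a \<notin> coatom i"
    using coatom_neq_carrier[of i] coatom(4)[of i] by auto
  then have "coatom i #> (a \<otimes> g) \<noteq> coatom i #> g"
    using coset_eq_iff[OF coatom(3), of "a \<otimes> g" g i] g by (simp add: m_assoc)
  then show "\<exists>h\<in>carrier G. coatom i #> h \<noteq> coatom i #> g" using a g by blast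
qed (use finite_G in auto)

text \<open>Two elements have the same \<open>i\<close>-th label iff their quotient lies in
  \<open>coatom i\<close>; intersecting over \<open>T\<close> gives a coset. The complement appears
  because \<open>T\<close> indexes the coatoms above the subgroup: more fixed labels, smaller
  subgroup.\<close>

lemma box_eq_coset:
  assumes "T \<subseteq> {..<N}" "g \<in> carrier G"
  shows "box T g = subgroup_of ({..<N} - T) #> g"
proof -
  have K: "subgroup (subgroup_of ({..<N} - T)) G" by (intro intervalD(1) subgroup_of(1)) auto
  have "h \<in> box T g \<longleftrightarrow> h \<in> subgroup_of ({..<N} - T) #> g" if h: "h \<in> carrier G" for h
    using h assms subgroup_of_Diff_eq[OF assms(1), of "h \<otimes> inv g"]
      subgroup.rcos_module[OF K is_group assms(2) h]
    by (simp add: mem_box coset_eq_iff[OF coatom(3)])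
  moreover have "subgroup_of ({..<N} - T) #> g \<subseteq> carrier G"
    using r_coset_subset_G[OF subgroup.subset[OF K] assms(2)] .
  ultimately show ?thesis using box_in_X by blast
qed

lemma coset_eq_box:
  assumes "K \<in> interval" "g \<in> carrier G"
  shows "K #> g = box ({..<N} - f K) g"
  using box_eq_coset[of "{..<N} - f K" g] assms f_subset[OF assms(1)]
  by (simp add: double_diff subgroup_of_f)

text \<open>Properness of the subgroup means that some label is fixed. The base point is immaterial,
  as \<open>box {} \<one>\<close> is the whole group.\<close>

lemma coset_poset_eq: "coset_poset G H = below {} \<one>"
proof (intro equalityI subsetI)
  fix Y assume "Y \<in> coset_poset G H"
  then obtain K g where K: "Y = K #> g" "K \<in> interval" "K \<noteq> carrier G" "g \<in> carrier G"
    by (auto simp: coset_poset_def)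
  have "f K \<noteq> {..<N}"
    using K(2,3) subgroup_of_f carrier_interval f_carrier by metis
  then have "{} \<subset> {..<N} - f K" using f_subset[OF K(2)] by blast
  moreover have "g \<in> box {} \<one>" using K(4) by (simp add: mem_box)
  ultimately show "Y \<in> below {} \<one>"
    unfolding K(1) coset_eq_box[OF K(2,4)] by (intro belowI Diff_subset)
next
  fix Y assume "Y \<in> below {} \<one>"
  then obtain S h where S: "Y = box S h" "{} \<subset> S" "S \<subseteq> {..<N}" "h \<in> carrier G"
    unfolding below_def using box_in_X by blast
  let ?K = "subgroup_of ({..<N} - S)"
  have K: "?K \<in> interval" "f ?K = {..<N} - S" by (intro subgroup_of Diff_subset)+
  then have "f ?K \<noteq> f (carrier G)" using S(2,3) f_carrier by blast
  then have "?K \<noteq> carrier G" by metis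
  then show "Y \<in> coset_poset G H"
    using S(1,4) K(1) box_eq_coset[OF S(3,4)] unfolding coset_poset_def by blast
qed

lemma coset_poset_hat_eq: "coset_poset_hat G H = insert {} boxes"
proof -
  have "box {} g = carrier G" for g by (auto simp: mem_box)
  moreover have "boxes = below {} \<one> \<union> {box {} \<one>}"
  proof (intro equalityI subsetI)
    fix Y assume "Y \<in> boxes"
    then obtain S g where S: "Y = box S g" "S \<subseteq> {..<N}" "g \<in> carrier G" by (auto simp: boxes_def)
    show "Y \<in> below {} \<one> \<union> {box {} \<one>}"
    proof (cases "S = {}")
      case True
      then show ?thesis using S(1) by (simp add: box_def)
    next
      case False
      then have "{} \<subset> S" by blast
      then show ?thesis using belowI[of "{}" S g \<one>] S by (simp add: mem_box)
    qed
  qed (use below_subset_boxes boxesI[of "{}" \<one>] in auto)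
  ultimately show ?thesis by (auto simp: coset_poset_hat_def coset_poset_eq)
qed

text \<open>The generated subgroup contains \<open>g\<close>, and with it every \<open>h\<close> in
  \<open>H\<close> as the product of \<open>h \<otimes> g\<close> and \<open>inv g\<close>. So it
  belongs to the interval, where an element is proper iff it lies below a coatom.\<close>

lemma generate_coset_eq_carrier:
  assumes g: "g \<in> carrier G"
  shows "generate G (H #> g) = carrier G \<longleftrightarrow> (\<forall>i<N. g \<notin> coatom i)"
proof -
  let ?K = "generate G (H #> g)"
  have sub: "H #> g \<subseteq> ?K" by (rule subsetI) (rule generate.incl)
  have cl: "H #> g \<subseteq> carrier G" by (rule r_coset_subset_G[OF subgroup.subset[OF subgroup_H] g])
  have sK: "subgroup ?K G" using generate_is_subgroup[OF cl] .
  have gK: "g \<in> ?K" by (rule subsetD[OF sub rcos_self[OF g subgroup_H]])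
  have "h \<in> ?K" if h: "h \<in> H" for h
  proof -
    have hc: "h \<in> carrier G" using h subgroup.subset[OF subgroup_H] by blast
    have "h \<otimes> g \<in> ?K" using rcosI[OF h subgroup.subset[OF subgroup_H] g] sub by blast
    then have "h \<otimes> g \<otimes> inv g \<in> ?K"
      by (rule subgroup.m_closed[OF sK _ subgroup.m_inv_closed[OF sK gK]])
    moreover have "h \<otimes> g \<otimes> inv g = h" using hc g by (simp add: m_assoc)
    ultimately show ?thesis by metis
  qed
  then have "H \<subseteq> ?K" by (rule subsetI)
  then have K: "?K \<in> interval" by (rule generate_interval[OF cl])
  have le: "?K \<subseteq> coatom i \<longleftrightarrow> g \<in> coatom i" for i
  proof
    assume "g \<in> coatom i"
    then have "h \<otimes> g \<in> coatom i" if "h \<in> H" for h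
      using that intervalD(2)[OF coatom(1), of i] subgroup.m_closed[OF coatom(3), of h i g] by blast
    then have "H #> g \<subseteq> coatom i" by (auto simp: r_coset_def)
    then show "?K \<subseteq> coatom i" using generate_subgroup_incl coatom(3) by blast
  qed (use gK in blast)
  have "?K = carrier G \<longleftrightarrow> f ?K = {..<N}"
    using subgroup_of_f K carrier_interval f_carrier by metis
  also have "\<dots> \<longleftrightarrow> (\<forall>i<N. i \<in> f ?K)" using f_subset[OF K] by blast
  also have "\<dots> \<longleftrightarrow> (\<forall>i<N. g \<notin> coatom i)" using le le_coatom_iff[OF K] by metis
  finally show ?thesis .
qed

text \<open>A coset of \<open>H\<close> is the set of all elements with a given full tuple of
  labels, every tuple occurs, and the coset generates iff no label is the coatom itself. Each coatom
  is proper, so every factor is positive.\<close>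

lemma euler_totient_eq:
  "euler_totient G H = (\<Prod>i<N. card ((\<lambda>g. coatom i #> g) ` carrier G) - 1)"
  and euler_totient_nonzero: "euler_totient G H \<noteq> 0"
proof -
  let ?B = "\<lambda>i. (\<lambda>g. coatom i #> g) ` carrier G - {coatom i}"
  let ?E = "{Y \<in> rcosets H. generate G Y = carrier G}"
  define F where "F \<phi> = {h \<in> carrier G. \<forall>i<N. coatom i #> h = \<phi> i}" for \<phi> :: "nat \<Rightarrow> 'a set"
  have H_box: "H #> g = box {..<N} g" if "g \<in> carrier G" for g
    using coset_eq_box[OF H_interval that] f_H by simp
  have realized: "\<exists>h\<in>carrier G. \<forall>i<N. coatom i #> h = \<phi> i" if "\<phi> \<in> Pi\<^sub>E {..<N} ?B" for \<phi>
    using that by (intro realize_cosets) (auto simp: PiE_iff)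
  have "inj_on F (Pi\<^sub>E {..<N} ?B)"
  proof (rule inj_onI)
    fix \<phi> \<psi> assume *: "\<phi> \<in> Pi\<^sub>E {..<N} ?B" "\<psi> \<in> Pi\<^sub>E {..<N} ?B" "F \<phi> = F \<psi>"
    obtain h where "h \<in> F \<phi>" using realized[OF *(1)] by (auto simp: F_def)
    moreover from this have "h \<in> F \<psi>" using *(3) by simp
    ultimately have "\<phi> i = \<psi> i" if "i < N" for i using that by (auto simp: F_def)
    then show "\<phi> = \<psi>" using *(1,2) by (intro PiE_ext) auto
  qed
  moreover have "F ` Pi\<^sub>E {..<N} ?B = ?E"
  proof (intro equalityI subsetI)
    fix Y assume "Y \<in> F ` Pi\<^sub>E {..<N} ?B"
    then obtain \<phi> where \<phi>: "\<phi> \<in> Pi\<^sub>E {..<N} ?B" "Y = F \<phi>" by blast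
    obtain h where h: "h \<in> carrier G" "\<And>i. i < N \<Longrightarrow> coatom i #> h = \<phi> i"
      using realized[OF \<phi>(1)] by blast
    have "Y = H #> h" using H_box[OF h(1)] h(2) by (auto simp: \<phi>(2) F_def mem_box)
    moreover have "h \<notin> coatom i" if "i < N" for i
      using h(2)[OF that] \<phi>(1) that coatom_coset_eq[OF h(1), of i] by (auto simp: PiE_iff)
    ultimately show "Y \<in> ?E"
      using generate_coset_eq_carrier[OF h(1)] h(1) by (auto simp: RCOSETS_def)
  next
    fix Y assume "Y \<in> ?E"
    then obtain g where g: "g \<in> carrier G" "Y = H #> g" "\<forall>i<N. g \<notin> coatom i"
      using generate_coset_eq_carrier by (auto simp: RCOSETS_def)
    define \<phi> where "\<phi> = restrict (\<lambda>i. coatom i #> g) {..<N}"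
    have "\<phi> \<in> Pi\<^sub>E {..<N} ?B" using g coatom_coset_eq[OF g(1)] by (auto simp: \<phi>_def)
    moreover have "Y = F \<phi>" using H_box[OF g(1)] by (auto simp: g(2) F_def \<phi>_def mem_box)
    ultimately show "Y \<in> F ` Pi\<^sub>E {..<N} ?B" by blast
  qed
  ultimately have "card ?E = card (Pi\<^sub>E {..<N} ?B)"
    using card_image by fastforce
  then have eq: "euler_totient G H = (\<Prod>i<N. card (?B i))"
    by (simp add: euler_totient_def card_PiE)
  have one: "coatom i \<in> (\<lambda>g. coatom i #> g) ` carrier G" for i
    using coset_mult_one[OF coatom(4)] by (metis image_eqI one_closed)
  then have "card (?B i) = card ((\<lambda>g. coatom i #> g) ` carrier G) - 1" for i
    using finite_G by (simp add: card_Diff_singleton)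
  with eq show "euler_totient G H = (\<Prod>i<N. card ((\<lambda>g. coatom i #> g) ` carrier G) - 1)" by simp
  have "card (?B i) \<noteq> 0" if i: "i < N" for i
  proof -
    obtain h where "h \<in> carrier G" "coatom i #> h \<noteq> coatom i #> \<one>"
      using other_label[of i \<one>] i by auto
    then have "coatom i #> h \<in> ?B i" using coset_mult_one[OF coatom(4)] by auto
    then show ?thesis using finite_G by (auto simp: card_eq_0_iff)
  qed
  then show "euler_totient G H \<noteq> 0" unfolding eq by (auto simp: prod_zero_iff)
qed

lemma reduced_betti_coset_poset:
  "reduced_betti (order_complex (coset_poset G H)) (int N - 1) = euler_totient G H"
  using concentrated_betti(1)[OF concentrated_below[of "{}" \<one>]]
  by (simp add: coset_poset_eq euler_totient_eq)

end

theorem theorem1p7: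
  fixes G :: "('a, 'b) monoid_scheme" and H :: "'a set" and n :: nat
  assumes "group G" and "finite (carrier G)" and "subgroup H G"
    and "boolean_interval G H (n + 1)"
    and "group_complemented G H"
  shows "cohen_macaulay (coset_poset_hat G H) \<and>
    reduced_betti (order_complex (coset_poset G H)) (int n) = euler_totient G H \<and>
    euler_totient G H \<noteq> 0"
proof -
  obtain f where "bij_betw f (subgroup_interval G H) (Pow {..<n + 1})"
    "\<forall>K\<in>subgroup_interval G H. \<forall>L\<in>subgroup_interval G H. K \<subseteq> L \<longleftrightarrow> f K \<subseteq> f L"
    using assms(4) by (auto simp: boolean_interval_def)
  then interpret group_complemented_boolean G H "n + 1" f
    using assms by (simp add: group_complemented_boolean_def group_complemented_boolean_axioms_def)
  show ?thesis
    \<comment> \<open>With \<open>n + 1\<close> coatoms the top degree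
      \<open>int (n + 1) - 1\<close> is \<open>int n\<close>.\<close>
    using cohen_macaulay_boxes reduced_betti_coset_poset euler_totient_nonzero
    by (simp add: coset_poset_hat_eq)
qed

end
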